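(* Let $h\ge 2$ be an even integer and let $r\ge 1$ be an integer. The graph $X_{h,r}$ is determined by its adjacency spectrum: if $Y$ is any finite simple graph whose adjacency spectrum (as a multiset) equals that of $X_{h,r}$, then $Y\cong X_{h,r}$.
   Context: All graphs are finite, simple and undirected. For an even integer $h\ge 2$ and an integer $r\ge 1$, the graph $X_{h,r}$ is defined as the join $$X_{h,r}=\overline{K}_{h-1}\vee\left(\bigvee_{i=1}^{r}\left(\tfrac h2\right)K_2\right),$$ where $\overline{K}_{h-1}$ is the edgeless graph on $h-1$ vertices, $\left(\frac h2\right)K_2$ is the disjoint union of $\frac h2$ copies of $K_2$, and the join $\vee$ of pairwise vertex-disjoint graphs is obtained from their disjoint union by adding all edges between vertices of different constituents. The adjacency spectrum of a graph is the multiset of eigenvalues of its adjacency matrix, counted with multiplicity. *)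

theory Defs
  imports
    "Graph_Theory.Pair_Digraph"
    "Graph_Theory.Digraph_Isomorphism"
    "Jordan_Normal_Form.Spectral_Radius"
begin

text \<open>
  A finite simple undirected graph is a pair digraph \<open>G\<close> satisfying \<^locale>\<open>pair_graph\<close>:
  finite vertex set, irreflexive symmetric arc relation. An edge \<open>uv\<close> is represented by the
  two arcs \<open>(u,v)\<close> and \<open>(v,u)\<close>.
\<close>

section \<open>The graphs \<open>X\<close>\<close>

definition edgeless_graph :: "nat \<Rightarrow> nat pair_pre_digraph" where
  "edgeless_graph n = \<lparr> pverts = {..<n}, parcs = {} \<rparr>"

definition complete_graph :: "nat \<Rightarrow> nat pair_pre_digraph" where
  "complete_graph n = \<lparr> pverts = {..<n}, parcs = {(u, v). u < n \<and> v < n \<and> u \<noteq> v} \<rparr>"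

text \<open>Vertices are tagged by the index of their constituent, so that constituents are
  pairwise vertex-disjoint.\<close>

definition disjoint_union_graph ::
    "'i set \<Rightarrow> ('i \<Rightarrow> 'a pair_pre_digraph) \<Rightarrow> ('i \<times> 'a) pair_pre_digraph" where
  "disjoint_union_graph I G =
     \<lparr> pverts = (SIGMA i:I. pverts (G i)),
       parcs = {((i, u), (i, v)) | i u v. i \<in> I \<and> (u, v) \<in> parcs (G i)} \<rparr>"

definition join_graph ::
    "'i set \<Rightarrow> ('i \<Rightarrow> 'a pair_pre_digraph) \<Rightarrow> ('i \<times> 'a) pair_pre_digraph" where
  "join_graph I G =
     \<lparr> pverts = pverts (disjoint_union_graph I G),
       parcs = parcs (disjoint_union_graph I G) \<union>
         {((i, u), (j, v)) | i j u v.
            i \<in> I \<and> j \<in> I \<and> i \<noteq> j \<and> u \<in> pverts (G i) \<and> v \<in> pverts (G j)} \<rparr>"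

text \<open>Binary join, allowing constituents with different vertex types.\<close>

definition join2_graph ::
    "'a pair_pre_digraph \<Rightarrow> 'b pair_pre_digraph \<Rightarrow> ('a + 'b) pair_pre_digraph" where
  "join2_graph G H =
     \<lparr> pverts = pverts G <+> pverts H,
       parcs = {(Inl u, Inl v) | u v. (u, v) \<in> parcs G} \<union>
               {(Inr u, Inr v) | u v. (u, v) \<in> parcs H} \<union>
               {(Inl u, Inr v) | u v. u \<in> pverts G \<and> v \<in> pverts H} \<union>
               {(Inr v, Inl u) | u v. u \<in> pverts G \<and> v \<in> pverts H} \<rparr>"

definition X_graph :: "nat \<Rightarrow> nat \<Rightarrow> (nat + nat \<times> nat \<times> nat) pair_pre_digraph" where
  "X_graph h r =
     join2_graph (edgeless_graph (h - 1))
       (join_graph {1..r} (\<lambda>_. disjoint_union_graph {1..h div 2} (\<lambda>_. complete_graph 2)))"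

lemma pair_graph_edgeless: "pair_graph (edgeless_graph n)"
  by unfold_locales (auto simp: edgeless_graph_def symmetric_def sym_def)

lemma pair_graph_complete: "pair_graph (complete_graph n)"
proof -
  have "parcs (complete_graph n) \<subseteq> {..<n} \<times> {..<n}"
    by (auto simp: complete_graph_def)
  then have "finite (parcs (complete_graph n))"
    by (rule finite_subset) simp
  then show ?thesis
    by unfold_locales (auto simp: complete_graph_def symmetric_def sym_def)
qed

lemma pair_graphI:
  assumes "finite (pverts G)" "parcs G \<subseteq> pverts G \<times> pverts G" "sym (parcs G)" "irrefl (parcs G)"
  shows "pair_graph G"
proof -
  have "finite (parcs G)"
    using assms(1,2) by (meson finite_SigmaI finite_subset)
  then show ?thesis
    using assms by unfold_locales (auto simp: symmetric_def irrefl_def)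
qed

lemma pair_graphD:
  assumes "pair_graph G"
  shows "finite (pverts G)" "parcs G \<subseteq> pverts G \<times> pverts G" "sym (parcs G)" "irrefl (parcs G)"
proof -
  interpret pair_graph G by fact
  show "finite (pverts G)" by (rule pair_finite_verts)
  show "parcs G \<subseteq> pverts G \<times> pverts G" by (auto dest: in_arcsD1 in_arcsD2)
  show "sym (parcs G)" using pair_sym_arcs by (simp add: symmetric_def)
  show "irrefl (parcs G)" using pair_no_loops by (force simp: irrefl_def)
qed

lemma pair_graph_disjoint_union:
  assumes "finite I" "\<And>i. i \<in> I \<Longrightarrow> pair_graph (G i)"
  shows "pair_graph (disjoint_union_graph I G)"
proof (rule pair_graphI)
  note G = pair_graphD[OF assms(2)]
  show "finite (pverts (disjoint_union_graph I G))"
    using assms(1) G(1) by (auto simp: disjoint_union_graph_def)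
  show "parcs (disjoint_union_graph I G) \<subseteq>
      pverts (disjoint_union_graph I G) \<times> pverts (disjoint_union_graph I G)"
    using G(2) by (auto simp: disjoint_union_graph_def)
  show "sym (parcs (disjoint_union_graph I G))"
    using symD[OF G(3)] by (auto simp: disjoint_union_graph_def intro!: symI)
  show "irrefl (parcs (disjoint_union_graph I G))"
    using G(4) by (auto simp: disjoint_union_graph_def irrefl_def)
qed

lemma pair_graph_join:
  assumes "finite I" "\<And>i. i \<in> I \<Longrightarrow> pair_graph (G i)"
  shows "pair_graph (join_graph I G)"
proof (rule pair_graphI)
  note D = pair_graphD[OF pair_graph_disjoint_union[of I G, OF assms]]
  show "finite (pverts (join_graph I G))"
    using D(1) by (simp add: join_graph_def)
  show "parcs (join_graph I G) \<subseteq> pverts (join_graph I G) \<times> pverts (join_graph I G)"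
    using D(2) by (auto simp: join_graph_def) (auto simp: disjoint_union_graph_def)
  show "sym (parcs (join_graph I G))"
    using D(3) by (auto simp: join_graph_def intro!: symI dest: symD)
  show "irrefl (parcs (join_graph I G))"
    using D(4) by (auto simp: join_graph_def irrefl_def)
qed

lemma pair_graph_join2:
  assumes "pair_graph G" "pair_graph H"
  shows "pair_graph (join2_graph G H)"
proof (rule pair_graphI)
  note D = pair_graphD[OF assms(1)] pair_graphD[OF assms(2)]
  show "finite (pverts (join2_graph G H))"
    using D(1,5) by (simp add: join2_graph_def)
  show "parcs (join2_graph G H) \<subseteq> pverts (join2_graph G H) \<times> pverts (join2_graph G H)"
    using D(2,6) by (auto simp: join2_graph_def)
  show "sym (parcs (join2_graph G H))"
    using D(3,7) by (auto simp: join2_graph_def intro!: symI dest: symD)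
  show "irrefl (parcs (join2_graph G H))"
    using D(4,8) by (auto simp: join2_graph_def irrefl_def)
qed

lemma pair_graph_X_graph: "pair_graph (X_graph h r)"
  unfolding X_graph_def
  by (intro pair_graph_join2 pair_graph_join pair_graph_disjoint_union pair_graph_edgeless
      pair_graph_complete finite_atLeastAtMost)


section \<open>The adjacency spectrum\<close>

definition adjacency_matrix :: "'a list \<Rightarrow> 'a pair_pre_digraph \<Rightarrow> complex mat" where
  "adjacency_matrix vs G =
     mat (length vs) (length vs) (\<lambda>(i, j). if (vs ! i, vs ! j) \<in> parcs G then 1 else 0)"

text \<open>
  The eigenvalues with (algebraic) multiplicity are the roots of the characteristic polynomial.
  Working over the complex numbers ensures that the multiset has one entry per vertex; the
  eigenvalues of this symmetric matrix are in fact real, so geometric and algebraic multiplicities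
  agree and the real spectrum is the same multiset. The choice of the vertex enumeration is
  immaterial, see \<open>adjacency_spectrum_eq\<close>.
\<close>

definition adjacency_spectrum :: "'a pair_pre_digraph \<Rightarrow> complex multiset" where
  "adjacency_spectrum G =
     proots (char_poly (adjacency_matrix (SOME vs. distinct vs \<and> set vs = pverts G) G))"

lemma adjacency_matrix_carrier:
  "adjacency_matrix vs G \<in> carrier_mat (length vs) (length vs)"
  by (simp add: adjacency_matrix_def)

lemma adjacency_matrix_similar:
  assumes "distinct vs" "distinct ws" "set vs = set ws"
  shows "similar_mat (adjacency_matrix vs G) (adjacency_matrix ws G)"
proof -
  define n where "n = length vs"
  have n: "length vs = n" "length ws = n"
    using assms distinct_card[of vs] distinct_card[of ws] by (simp_all add: n_def)
  define P where "P = (\<lambda>vs ws. mat n n (\<lambda>(i, j). if vs ! i = (ws ! j :: 'a) then (1::complex) else 0))"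
  have pick: "(\<Sum>k<n. (if us ! k = x then f (us ! k) else 0)) = f x"
    if us: "distinct us" "length us = n" "x \<in> set us" for us :: "'a list" and x and f :: "'a \<Rightarrow> complex"
  proof -
    obtain m where m: "m < n" "us ! m = x"
      using us by (auto simp: in_set_conv_nth)
    have "(\<Sum>k<n. (if us ! k = x then f (us ! k) else 0)) = (\<Sum>k<n. if k = m then f x else 0)"
      using m(1) nth_eq_iff_index_eq[OF us(1), of _ m] us(2)
      by (intro sum.cong) (simp_all add: m(2)[symmetric])
    also have "\<dots> = f x" using m by simp
    finally show ?thesis .
  qed
  have PP: "P us us' * P us' us = 1\<^sub>m n"
    if us: "distinct us" "length us = n" "distinct us'" "length us' = n" "set us = set us'" for us us'
  proof (rule eq_matI)
    fix i j assume ij: "i < dim_row (1\<^sub>m n :: complex mat)" "j < dim_col (1\<^sub>m n :: complex mat)"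
    have "(P us us' * P us' us) $$ (i, j) =
      (\<Sum>k<n. if us' ! k = us ! i then (if us' ! k = us ! j then 1 else 0) else 0)"
      using ij by (simp add: P_def scalar_prod_def lessThan_atLeast0)
        (intro sum.cong, auto)
    also have "\<dots> = (if us ! i = us ! j then 1 else 0)"
      using ij us by (subst pick[of us' "us ! i" "\<lambda>x. if x = us ! j then 1 else 0"])
        (use nth_mem[of i us] in simp_all)
    also have "\<dots> = 1\<^sub>m n $$ (i, j)"
      using ij nth_eq_iff_index_eq[OF us(1), of i j] us(2) by simp
    finally show "(P us us' * P us' us) $$ (i, j) = 1\<^sub>m n $$ (i, j)" .
  qed (auto simp: P_def)
  have comm: "adjacency_matrix vs G * P vs ws = P vs ws * adjacency_matrix ws G"
  proof (rule eq_matI)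
    fix i j assume "i < dim_row (P vs ws * adjacency_matrix ws G)"
      "j < dim_col (P vs ws * adjacency_matrix ws G)"
    then have ij: "i < n" "j < n"
      using n by (auto simp: P_def adjacency_matrix_def)
    let ?a = "\<lambda>x y. if (x, y) \<in> parcs G then 1 else (0::complex)"
    have mem: "vs ! i \<in> set ws" "ws ! j \<in> set vs"
      using ij n assms(3) nth_mem[of i vs] nth_mem[of j ws] by simp_all
    have "(adjacency_matrix vs G * P vs ws) $$ (i, j) =
      (\<Sum>k<n. if vs ! k = ws ! j then ?a (vs ! i) (vs ! k) else 0)"
      using ij n by (simp add: P_def adjacency_matrix_def scalar_prod_def lessThan_atLeast0)
        (intro sum.cong, auto)
    also have "\<dots> = ?a (vs ! i) (ws ! j)"
      by (rule pick[where f = "\<lambda>x. ?a (vs ! i) x"]) (use assms n mem in simp_all)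
    also have "\<dots> = (\<Sum>k<n. if ws ! k = vs ! i then ?a (ws ! k) (ws ! j) else 0)"
      by (rule pick[where f = "\<lambda>x. ?a x (ws ! j)", symmetric]) (use assms n mem in simp_all)
    also have "\<dots> = (P vs ws * adjacency_matrix ws G) $$ (i, j)"
      using ij n by (simp add: P_def adjacency_matrix_def scalar_prod_def lessThan_atLeast0)
        (intro sum.cong, auto)
    finally show "(adjacency_matrix vs G * P vs ws) $$ (i, j) =
      (P vs ws * adjacency_matrix ws G) $$ (i, j)" .
  qed (use n in \<open>auto simp: P_def adjacency_matrix_def\<close>)
  have car: "P us us' \<in> carrier_mat n n" for us us' by (simp add: P_def)
  have carA: "adjacency_matrix vs G \<in> carrier_mat n n" "adjacency_matrix ws G \<in> carrier_mat n n"
    using adjacency_matrix_carrier[of vs G] adjacency_matrix_carrier[of ws G] n by simp_all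
  have PP1: "P vs ws * P ws vs = 1\<^sub>m n" and PP2: "P ws vs * P vs ws = 1\<^sub>m n"
    by (rule PP; use assms n in simp)+
  have "adjacency_matrix vs G = adjacency_matrix vs G * (P vs ws * P ws vs)"
    using carA by (simp add: PP1)
  also have "\<dots> = P vs ws * adjacency_matrix ws G * P ws vs"
    by (simp only: assoc_mult_mat[OF carA(1) car[of vs ws] car[of ws vs], symmetric] comm)
  finally have "similar_mat_wit (adjacency_matrix vs G) (adjacency_matrix ws G) (P vs ws) (P ws vs)"
    by (rule similar_mat_witI[OF PP1 PP2 _ carA car car])
  then show ?thesis
    by (auto simp: similar_mat_def)
qed

lemma adjacency_spectrum_eq:
  assumes "distinct vs" "set vs = pverts G"
  shows "adjacency_spectrum G = proots (char_poly (adjacency_matrix vs G))"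
proof -
  define ws where "ws = (SOME vs. distinct vs \<and> set vs = pverts G)"
  have "distinct ws \<and> set ws = pverts G"
    unfolding ws_def by (rule someI[of _ vs]) (use assms in simp)
  then have "similar_mat (adjacency_matrix ws G) (adjacency_matrix vs G)"
    using assms by (intro adjacency_matrix_similar) simp_all
  then show ?thesis
    unfolding adjacency_spectrum_def ws_def[symmetric] by (simp add: char_poly_similar)
qed

lemma
  assumes "distinct vs" "set vs = pverts G"
  shows set_adjacency_spectrum: "set_mset (adjacency_spectrum G) = spectrum (adjacency_matrix vs G)"
    and size_adjacency_spectrum: "size (adjacency_spectrum G) = card (pverts G)"
proof -
  note A = adjacency_matrix_carrier[of vs G]
  have "char_poly (adjacency_matrix vs G) \<noteq> 0"
    using degree_monic_char_poly[OF A] by auto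
  then show "set_mset (adjacency_spectrum G) = spectrum (adjacency_matrix vs G)"
    using adjacency_spectrum_eq[OF assms] spectrum_root_char_poly[OF A] by simp
  show "size (adjacency_spectrum G) = card (pverts G)"
    using adjacency_spectrum_eq[OF assms] degree_monic_char_poly[OF A] distinct_card[OF assms(1)] assms(2)
    by (simp add: size_proots_complex)
qed

end

theory Submission
  imports Defs "HOL-Analysis.Convex" "HOL-Library.Indicator_Function"
begin

text \<open>
  Cospectral graphs have the same number of closed walks of each length, and this is all that is
  used about the spectrum. Put \<open>k = rh\<close> and \<open>d = h - 1\<close>; the graph \<open>X\<close> is \<open>k\<close>-regular on \<open>k + d\<close>
  vertices and its adjacency operator satisfies \<open>A\<^sup>4 + d A\<^sup>3 - A\<^sup>2 - d A = (k\<^sup>3 - k) J\<close>. Regularity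
  and this identity can be expressed by closed walk counts (the squared Frobenius norm of a polynomial in
  \<open>A\<close> is a trace), so both pass to \<open>Y\<close>. The identity makes \<open>A\<^sup>3 - A\<close> constant on each connected
  component of the complement of \<open>Y\<close>, which expresses the size of the component of \<open>v\<close> by the
  number of closed 3-walks at \<open>v\<close>; positive semidefiniteness then bounds the size by \<open>h\<close>. As the complement
  is \<open>(h - 2)\<close>-regular, every component has \<open>h - 1\<close> or \<open>h\<close> vertices, so it is a complete graph or the
  complement of a perfect matching, and the total number of closed 3-walks shows that exactly one
  component has \<open>h - 1\<close> vertices. For \<open>h = 2\<close> both graphs are complete.
\<close>

section \<open>Traces of matrix powers and the spectrum\<close>

text \<open>The diagonal sum is the trace, and its cyclicity moves \<open>Q\<close> to the front,
  where \<open>Q * P\<close> cancels.\<close>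

lemma mat_pow_diag_sum_similar:
  fixes A B :: "'a :: comm_ring_1 mat"
  assumes wit: "similar_mat_wit A B P Q" and A: "A \<in> carrier_mat n n"
  shows "(\<Sum>i<n. (A ^\<^sub>m j) $$ (i, i)) = (\<Sum>i<n. (B ^\<^sub>m j) $$ (i, i))"
proof -
  note w = similar_mat_witD2[OF A wit]
  let ?M = "B ^\<^sub>m j"
  have M: "?M \<in> carrier_mat n n"
    using w by simp
  have entry: "(C * D) $$ (i, l) = (\<Sum>k<n. C $$ (i, k) * D $$ (k, l))"
    if "C \<in> carrier_mat n n" "D \<in> carrier_mat n n" "i < n" "l < n" for C D :: "'a mat" and i l
    using that by (auto simp: scalar_prod_def lessThan_atLeast0)
  have "(\<Sum>i<n. (A ^\<^sub>m j) $$ (i, i)) = (\<Sum>i<n. ((P * ?M) * Q) $$ (i, i))"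
    by (simp add: similar_mat_wit_pow_id[OF wit])
  also have "\<dots> = (\<Sum>i<n. \<Sum>k<n. (P * ?M) $$ (i, k) * Q $$ (k, i))"
    by (intro sum.cong refl entry mult_carrier_mat[OF w(6) M] w(7)) auto
  also have "\<dots> = (\<Sum>k<n. \<Sum>i<n. Q $$ (k, i) * (P * ?M) $$ (i, k))"
    by (subst sum.swap) (simp add: mult.commute)
  also have "\<dots> = (\<Sum>k<n. (Q * (P * ?M)) $$ (k, k))"
    by (intro sum.cong refl entry[symmetric] mult_carrier_mat[OF w(6) M] w(7)) auto
  also have "Q * (P * ?M) = (Q * P) * ?M"
    by (rule assoc_mult_mat[OF w(7) w(6) M, symmetric])
  also have "\<dots> = ?M"
    by (simp only: w(2) left_mult_one_mat[OF M])
  finally show ?thesis .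
qed

lemma upper_triangular_pow:
  fixes B :: "'a :: comm_ring_1 mat"
  assumes B: "B \<in> carrier_mat n n" and ut: "upper_triangular B"
  shows "upper_triangular (B ^\<^sub>m j) \<and> (\<forall>i<n. (B ^\<^sub>m j) $$ (i, i) = (B $$ (i, i)) ^ j)"
proof (induction j)
  case 0
  then show ?case using B by simp
next
  case (Suc j)
  let ?M = "B ^\<^sub>m j"
  have M: "?M \<in> carrier_mat n n"
    using B by simp
  have entry: "(?M * B) $$ (i, l) = (\<Sum>k<n. ?M $$ (i, k) * B $$ (k, l))" if "i < n" "l < n" for i l
    using that M B by (auto simp: scalar_prod_def lessThan_atLeast0)
  have up: "k < n \<Longrightarrow> i < k \<Longrightarrow> ?M $$ (k, i) = 0" "k < n \<Longrightarrow> i < k \<Longrightarrow> B $$ (k, i) = 0" for i k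
    using upper_triangularD[of ?M i k] upper_triangularD[of B i k] Suc.IH M B ut by simp_all
  have below: "(?M * B) $$ (i, l) = 0" if "i < n" "l < i" for i l
    unfolding entry[OF that(1) less_trans[OF that(2,1)]]
  proof (rule sum.neutral, rule ballI)
    fix k assume "k \<in> {..<n}"
    then show "?M $$ (i, k) * B $$ (k, l) = 0"
      using up(1)[of i k] up(2)[of k l] that by (cases "k < i") auto
  qed
  have diag: "(?M * B) $$ (i, i) = ?M $$ (i, i) * B $$ (i, i)" if i: "i < n" for i
  proof -
    have "(?M * B) $$ (i, i) = (\<Sum>k<n. if k = i then ?M $$ (i, i) * B $$ (i, i) else 0)"
      unfolding entry[OF i i]
    proof (rule sum.cong[OF refl])
      fix k assume "k \<in> {..<n}"
      then show "?M $$ (i, k) * B $$ (k, i) = (if k = i then ?M $$ (i, i) * B $$ (i, i) else 0)"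
        using up(1)[of i k] up(1)[of k i] up(2)[of k i] i
        by (cases k i rule: linorder_cases) auto
    qed
    then show ?thesis
      using i by simp
  qed
  show ?case
  proof (intro conjI allI impI)
    show "upper_triangular (B ^\<^sub>m Suc j)"
      using below M B by (intro upper_triangularI) simp
    fix i assume "i < n"
    then show "(B ^\<^sub>m Suc j) $$ (i, i) = (B $$ (i, i)) ^ Suc j"
      using diag[of i] Suc.IH by (simp add: mult.commute)
  qed
qed

text \<open>Schur triangularization puts the roots, with algebraic multiplicity, on the diagonal of
  a similar triangular matrix, and powers of that matrix act entrywise on its diagonal.\<close>

lemma mat_pow_diag_sum_char_poly:
  fixes A :: "complex mat"
  assumes A: "A \<in> carrier_mat n n" and fac: "char_poly A = (\<Prod>a\<leftarrow>as. [:- a, 1:])"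
  shows "(\<Sum>i<n. (A ^\<^sub>m j) $$ (i, i)) = (\<Sum>a\<leftarrow>as. a ^ j)"
proof -
  obtain B P Q where dec: "schur_decomposition A as = (B, P, Q)"
    by (cases "schur_decomposition A as") auto
  have wit: "similar_mat_wit A B P Q" and ut: "upper_triangular B" and diag: "diag_mat B = as"
    using schur_decomposition[OF A fac dec] by auto
  have B: "B \<in> carrier_mat n n"
    using similar_mat_witD2[OF A wit] by simp
  have "(\<Sum>i<n. (A ^\<^sub>m j) $$ (i, i)) = (\<Sum>i<n. (B $$ (i, i)) ^ j)"
    using mat_pow_diag_sum_similar[OF wit A] upper_triangular_pow[OF B ut] by simp
  also have "\<dots> = (\<Sum>a\<leftarrow>diag_mat B. a ^ j)"
    using B by (simp add: diag_mat_def comp_def interv_sum_list_conv_sum_set_nat lessThan_atLeast0)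
  finally show ?thesis
    by (simp add: diag)
qed

lemma mat_pow_diag_sum_proots:
  fixes A :: "complex mat"
  assumes A: "A \<in> carrier_mat n n"
  shows "(\<Sum>i<n. (A ^\<^sub>m j) $$ (i, i)) = (\<Sum>a\<in>#proots (char_poly A). a ^ j)"
proof -
  obtain as where fac: "char_poly A = (\<Prod>a\<leftarrow>as. [:- a, 1:])"
    using char_poly_factorized[OF A] by blast
  have "proots (\<Prod>a\<leftarrow>as. [:- a, 1:]) = mset as" for as :: "complex list"
  proof (induction as)
    case (Cons a as)
    have "(\<Prod>b\<leftarrow>as. [:- b, 1:]) \<noteq> 0"
      by (auto simp: prod_list_zero_iff)
    then show ?case
      using Cons by (simp add: proots_mult del: mult_pCons_left)
  qed simp
  then have "proots (char_poly A) = mset as"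
    by (simp add: fac)
  moreover have "(\<Sum>a\<in>#mset as. a ^ j) = (\<Sum>a\<leftarrow>as. a ^ j)"
    by (metis mset_map sum_mset_sum_list)
  ultimately show ?thesis
    by (simp add: mat_pow_diag_sum_char_poly[OF A fac])
qed

section \<open>Walk counts\<close>

text \<open>The adjacency operator on real functions, a form that avoids enumerating the
  vertices.\<close>

definition nbr_sum :: "'a rel \<Rightarrow> ('a \<Rightarrow> real) \<Rightarrow> 'a \<Rightarrow> real" where
  "nbr_sum E f u = (\<Sum>v\<in>E `` {u}. f v)"

text \<open>Column \<open>v\<close> of A^j, as the iterated operator on a unit vector. For finite
  symmetric \<open>E\<close> its value at \<open>u\<close> counts the walks of length
  \<open>j\<close> from \<open>v\<close> to \<open>u\<close>.\<close>

definition walks :: "'a rel \<Rightarrow> nat \<Rightarrow> 'a \<Rightarrow> 'a \<Rightarrow> real" where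
  "walks E j v = (nbr_sum E ^^ j) (indicator {v})"

definition closed_walks :: "'a set \<Rightarrow> 'a rel \<Rightarrow> nat \<Rightarrow> real" where
  "closed_walks V E j = (\<Sum>v\<in>V. walks E j v v)"

lemma walks_0: "walks E 0 v = indicator {v}"
  by (simp add: walks_def)

lemma walks_Suc: "walks E (Suc j) v = nbr_sum E (walks E j v)"
  by (simp add: walks_def)

lemma nbr_sum_add: "nbr_sum E (\<lambda>v. f v + g v) u = nbr_sum E f u + nbr_sum E g u"
  by (simp add: nbr_sum_def sum.distrib)

lemma nbr_sum_diff: "nbr_sum E (\<lambda>v. f v - g v) u = nbr_sum E f u - nbr_sum E g u"
  by (simp add: nbr_sum_def sum_subtractf)

lemma nbr_sum_mult: "nbr_sum E (\<lambda>v. c * f v) u = c * nbr_sum E f u"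
  by (simp add: nbr_sum_def sum_distrib_left)

lemma nbr_sum_sum: "nbr_sum E (\<lambda>v. \<Sum>i\<in>I. f i v) u = (\<Sum>i\<in>I. nbr_sum E (f i) u)"
  unfolding nbr_sum_def by (rule sum.swap)

lemma nbr_sum_mono: "(\<And>v. f v \<le> g v) \<Longrightarrow> nbr_sum E f u \<le> nbr_sum E g u"
  by (simp add: nbr_sum_def sum_mono)

locale sym_graph =
  fixes V :: "'a set" and E :: "'a rel"
  assumes fin: "finite V" and sub: "E \<subseteq> V \<times> V" and sym_E: "sym E"
begin

lemma nbrs_subset: "E `` {u} \<subseteq> V"
  using sub by auto

lemma finite_nbrs: "finite (E `` {u})"
  using nbrs_subset fin by (rule finite_subset)

lemma nbr_sum_conv: "nbr_sum E f u = (\<Sum>v\<in>V. if (u, v) \<in> E then f v else 0)"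
proof -
  have "E `` {u} = {v \<in> V. (u, v) \<in> E}"
    using sub by auto
  then show ?thesis
    by (simp add: nbr_sum_def sum.inter_filter[OF fin])
qed

lemma nbr_sum_cong: "(\<And>v. v \<in> V \<Longrightarrow> f v = g v) \<Longrightarrow> nbr_sum E f u = nbr_sum E g u"
  unfolding nbr_sum_conv by (rule sum.cong) auto

lemma nbr_sum_adjoint: "(\<Sum>u\<in>V. nbr_sum E f u * g u) = (\<Sum>u\<in>V. f u * nbr_sum E g u)"
proof -
  have "(\<Sum>u\<in>V. nbr_sum E f u * g u) = (\<Sum>u\<in>V. \<Sum>v\<in>V. if (u, v) \<in> E then f v * g u else 0)"
    unfolding nbr_sum_conv sum_distrib_right by (intro sum.cong) auto
  also have "\<dots> = (\<Sum>v\<in>V. \<Sum>u\<in>V. if (v, u) \<in> E then f v * g u else 0)"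
    using symD[OF sym_E] by (subst sum.swap) (intro sum.cong, auto)
  also have "\<dots> = (\<Sum>u\<in>V. f u * nbr_sum E g u)"
    unfolding nbr_sum_conv sum_distrib_left by (intro sum.cong) auto
  finally show ?thesis .
qed

lemma nbr_sum_pow_adjoint:
  "(\<Sum>u\<in>V. (nbr_sum E ^^ j) f u * g u) = (\<Sum>u\<in>V. f u * (nbr_sum E ^^ j) g u)"
proof (induction j arbitrary: g)
  case (Suc j)
  then show ?case
    by (simp add: nbr_sum_adjoint) (simp flip: funpow_swap1)
qed simp

lemma sum_indicator_mult: "v \<in> V \<Longrightarrow> (\<Sum>u\<in>V. indicator {v} u * g u) = (g v :: real)"
  using fin by (simp add: indicator_def if_distrib[of "\<lambda>x. x * _"] sum.delta cong: if_cong)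

lemma sum_nbr_sum: "(\<Sum>u\<in>V. nbr_sum E f u) = (\<Sum>u\<in>V. f u * card (E `` {u}))"
  using nbr_sum_adjoint[of f "\<lambda>_. 1"] by (simp add: nbr_sum_def)

text \<open>Self-adjointness: <A^i e_v, A^j e_v> = <e_v, A^(i+j) e_v>. This is how norms turn into
  closed walk counts.\<close>

lemma walks_dot:
  assumes "v \<in> V"
  shows "(\<Sum>u\<in>V. walks E i v u * walks E j v u) = walks E (i + j) v v"
  using nbr_sum_pow_adjoint[of i "indicator {v}" "walks E j v"] sum_indicator_mult[OF assms]
  by (simp add: walks_def funpow_add)

lemma nbr_sum_pow_expand:
  assumes u: "u \<in> V"
  shows "(nbr_sum E ^^ j) f u = (\<Sum>v\<in>V. f v * walks E j v u)"
  using u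
proof (induction j arbitrary: u)
  case 0
  have "(\<Sum>v\<in>V. f v * walks E 0 v u) = (\<Sum>v\<in>V. indicator {u} v * f v)"
    by (intro sum.cong) (auto simp: walks_0 indicator_def)
  then show ?case
    using sum_indicator_mult[OF 0, of f] by simp
next
  case (Suc j)
  have "(nbr_sum E ^^ Suc j) f u = nbr_sum E (\<lambda>u. \<Sum>v\<in>V. f v * walks E j v u) u"
    by (auto intro: nbr_sum_cong Suc.IH)
  also have "\<dots> = (\<Sum>v\<in>V. f v * walks E (Suc j) v u)"
    by (simp add: nbr_sum_sum nbr_sum_mult walks_Suc)
  finally show ?case .
qed

lemma walks_2: "u \<in> V \<Longrightarrow> walks E 2 u u = card (E `` {u})"
proof -
  assume u: "u \<in> V"
  have "walks E 1 u v = (if (u, v) \<in> E then 1 else 0)" if "v \<in> V" for v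
    using sum_indicator_mult[OF u, of "\<lambda>w. if (v, w) \<in> E then 1 else 0"] symD[OF sym_E]
    by (auto simp: walks_Suc walks_0 nbr_sum_conv if_distrib[of "\<lambda>x. _ * x"] cong: if_cong)
  then have "walks E (Suc 1) u u = nbr_sum E (\<lambda>v. if (u, v) \<in> E then 1 else 0) u"
    unfolding walks_Suc[of E 1] by (rule nbr_sum_cong)
  then show ?thesis
    by (simp add: nbr_sum_def numeral_2_eq_2)
qed

end

section \<open>Matrix powers, walk counts and power sums of the eigenvalues\<close>

lemma pow_mat_Suc_left:
  assumes A: "A \<in> carrier_mat n n"
  shows "A ^\<^sub>m Suc j = A * A ^\<^sub>m j"
proof (induction j)
  case (Suc j)
  have "A ^\<^sub>m Suc (Suc j) = (A * A ^\<^sub>m j) * A"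
    using Suc by simp
  also have "\<dots> = A * (A ^\<^sub>m j * A)"
    by (rule assoc_mult_mat[OF A pow_carrier_mat[OF A] A])
  finally show ?case by simp
qed (use A in simp)

lemma adjacency_matrix_pow_entry:
  assumes vs: "distinct vs" "set vs = pverts G" and G: "sym_graph (pverts G) (parcs G)"
    and "i < length vs" "l < length vs"
  shows "(adjacency_matrix vs G ^\<^sub>m j) $$ (i, l) = complex_of_real (walks (parcs G) j (vs ! l) (vs ! i))"
  using assms(4)
proof (induction j arbitrary: i)
  case 0
  then show ?case
    using nth_eq_iff_index_eq[OF vs(1), of i l] assms(5)
    by (auto simp: walks_0 indicator_def adjacency_matrix_def)
next
  case (Suc j)
  interpret sym_graph "pverts G" "parcs G" by fact
  let ?A = "adjacency_matrix vs G" and ?n = "length vs"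
  note A = adjacency_matrix_carrier[of vs G]
  have M: "?A ^\<^sub>m j \<in> carrier_mat ?n ?n"
    using A by simp
  \<comment> \<open>Matrix powers unfold on the right, whereas the outermost \<open>nbr_sum\<close>
    is a factor on the left.\<close>
  have "?A ^\<^sub>m Suc j = ?A * ?A ^\<^sub>m j"
    by (rule pow_mat_Suc_left[OF A])
  then have "(?A ^\<^sub>m Suc j) $$ (i, l) = (\<Sum>k<?n. ?A $$ (i, k) * (?A ^\<^sub>m j) $$ (k, l))"
    using A M Suc.prems assms(5) by (simp add: scalar_prod_def lessThan_atLeast0)
  also have "\<dots> = (\<Sum>k<?n. complex_of_real (if (vs ! i, vs ! k) \<in> parcs G
      then walks (parcs G) j (vs ! l) (vs ! k) else 0))"
  proof (rule sum.cong[OF refl])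
    fix k assume "k \<in> {..<?n}"
    then have "?A $$ (i, k) = (if (vs ! i, vs ! k) \<in> parcs G then 1 else 0)"
      using Suc.prems by (simp add: adjacency_matrix_def)
    with \<open>k \<in> {..<?n}\<close> show "?A $$ (i, k) * (?A ^\<^sub>m j) $$ (k, l) = complex_of_real
        (if (vs ! i, vs ! k) \<in> parcs G then walks (parcs G) j (vs ! l) (vs ! k) else 0)"
      by (simp add: Suc.IH)
  qed
  also have "\<dots> = complex_of_real (\<Sum>v\<in>pverts G. if (vs ! i, v) \<in> parcs G
      then walks (parcs G) j (vs ! l) v else 0)"
    unfolding of_real_sum
    by (rule sum.reindex_bij_betw) (use bij_betw_nth[OF vs(1) refl refl] vs(2) in simp)
  finally show ?case
    by (simp add: walks_Suc nbr_sum_conv)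
qed

lemma closed_walks_spectrum:
  assumes G: "sym_graph (pverts G) (parcs G)"
  shows "complex_of_real (closed_walks (pverts G) (parcs G) j) = (\<Sum>a\<in>#adjacency_spectrum G. a ^ j)"
proof -
  interpret sym_graph "pverts G" "parcs G" by fact
  obtain vs where vs: "set vs = pverts G" "distinct vs"
    using finite_distinct_list[OF fin] by blast
  have "(\<Sum>a\<in>#adjacency_spectrum G. a ^ j) = (\<Sum>i<length vs. (adjacency_matrix vs G ^\<^sub>m j) $$ (i, i))"
    unfolding adjacency_spectrum_eq[OF vs(2,1)]
    by (rule mat_pow_diag_sum_proots[OF adjacency_matrix_carrier, symmetric])
  also have "\<dots> = (\<Sum>i<length vs. complex_of_real (walks (parcs G) j (vs ! i) (vs ! i)))"
    using adjacency_matrix_pow_entry[OF vs(2,1) G] by simp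
  also have "\<dots> = (\<Sum>v\<in>pverts G. complex_of_real (walks (parcs G) j v v))"
    by (rule sum.reindex_bij_betw) (use bij_betw_nth[OF vs(2) refl refl] vs(1) in simp)
  finally show ?thesis
    by (simp add: closed_walks_def)
qed

text \<open>Closed walk counts are power sums of the eigenvalues. The rest of the proof accesses the
  spectrum only through this lemma.\<close>

lemma closed_walks_cospectral:
  assumes "sym_graph (pverts G) (parcs G)" "sym_graph (pverts H) (parcs H)"
    and "adjacency_spectrum G = adjacency_spectrum H"
  shows "closed_walks (pverts G) (parcs G) j = closed_walks (pverts H) (parcs H) j"
  using closed_walks_spectrum[OF assms(1), of j] closed_walks_spectrum[OF assms(2), of j] assms(3)
  by (metis of_real_eq_iff)

lemma closed_walks_0: "closed_walks V E 0 = card V"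
  by (simp add: closed_walks_def walks_0)

lemma (in sym_graph) closed_walks_2: "closed_walks V E 2 = (\<Sum>v\<in>V. real (card (E `` {v})))"
  by (simp add: closed_walks_def walks_2)

section \<open>Graphs with the closed walk counts of a regular graph\<close>

text \<open>Log-convexity makes the ratios of consecutive terms nondecreasing. A first ratio
  \<open>q\<close> above \<open>x\<close> would force growth at least like \<open>q ^ j\<close>,
  eventually beyond \<open>C * x ^ j\<close>.\<close>

lemma log_convex_growth:
  fixes a :: "nat \<Rightarrow> real"
  assumes nonneg: "\<And>j. 0 \<le> a j" and conv: "\<And>j. (a (Suc j))\<^sup>2 \<le> a j * a (Suc (Suc j))"
    and bound: "\<And>j. a j \<le> C * x ^ j" and x: "0 \<le> x"
  shows "a 1 \<le> x * a 0"
proof (rule ccontr)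
  assume "\<not> a 1 \<le> x * a 0"
  then have less: "x * a 0 < a 1" by simp
  have a0: "a 0 > 0"
  proof (rule ccontr)
    assume "\<not> a 0 > 0"
    then have "a 0 = 0" using nonneg[of 0] by simp
    then show False using conv[of 0] less by simp
  qed
  define q where "q = a 1 / a 0"
  have q: "x < q" and a1: "a 1 = q * a 0"
    using less a0 by (simp_all add: q_def field_simps)
  then have "q > 0" using x by simp
  have grow: "a j > 0 \<and> a (Suc j) \<ge> q * a j" for j
  proof (induction j)
    case 0
    then show ?case using a0 a1 by simp
  next
    case (Suc j)
    have pos: "a (Suc j) > 0"
      using Suc \<open>q > 0\<close> by (meson less_le_trans mult_pos_pos)
    have "a j * (q * a (Suc j)) = (q * a j) * a (Suc j)" by simp
    also have "\<dots> \<le> a (Suc j) * a (Suc j)"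
      using Suc pos by (intro mult_right_mono) auto
    also have "\<dots> \<le> a j * a (Suc (Suc j))"
      using conv[of j] by (simp add: power2_eq_square)
    finally show ?case using Suc pos by simp
  qed
  have geo: "q ^ j * a 0 \<le> a j" for j
  proof (induction j)
    case (Suc j)
    have "q ^ Suc j * a 0 = q * (q ^ j * a 0)" by simp
    also have "\<dots> \<le> q * a j"
      using Suc \<open>q > 0\<close> by (intro mult_left_mono) auto
    finally show ?case using grow[of j] by linarith
  qed simp
  show False
  \<comment> \<open>The Archimedean argument uses \<open>q / x\<close> with positive
    \<open>x\<close>; for \<open>x = 0\<close> the bound at exponent 1 already contradicts
    \<open>q > 0\<close>.\<close>
  proof (cases "x = 0")
    case True
    then have "q * a 0 \<le> 0"
      using bound[of 1] geo[of 1] by simp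
    then show ?thesis using mult_pos_pos[OF \<open>q > 0\<close> a0] by linarith
  next
    case False
    then have "x > 0" using x by simp
    then obtain j where "C / a 0 < (q / x) ^ j"
      using real_arch_pow[of "q / x" "C / a 0"] q by (auto simp: field_simps)
    then have "C * x ^ j < q ^ j * a 0"
      using \<open>x > 0\<close> a0 by (simp add: field_simps)
    then show ?thesis using geo[of j] bound[of j] by linarith
  qed
qed

section \<open>Norm estimates for powers of the adjacency operator\<close>

context sym_graph
begin

text \<open>Cauchy-Schwarz at each vertex bounds A^j 1 by the Frobenius norm of A^j, whose square is
  the trace of A^(2j).\<close>

lemma sum_pow_ones_sq_le:
  "(\<Sum>u\<in>V. ((nbr_sum E ^^ j) (\<lambda>_. 1) u)\<^sup>2) \<le> card V * closed_walks V E (2 * j)"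
proof -
  have "(\<Sum>u\<in>V. ((nbr_sum E ^^ j) (\<lambda>_. 1) u)\<^sup>2) \<le> (\<Sum>u\<in>V. card V * (\<Sum>v\<in>V. (walks E j v u)\<^sup>2))"
  proof (rule sum_mono)
    fix u assume "u \<in> V"
    then show "((nbr_sum E ^^ j) (\<lambda>_. 1) u)\<^sup>2 \<le> card V * (\<Sum>v\<in>V. (walks E j v u)\<^sup>2)"
      using sum_squared_le_sum_of_squares[of "\<lambda>v. walks E j v u" V]
      by (simp add: nbr_sum_pow_expand mult.commute)
  qed
  also have "\<dots> = card V * (\<Sum>v\<in>V. \<Sum>u\<in>V. walks E j v u * walks E j v u)"
    by (subst sum.swap) (simp add: power2_eq_square flip: sum_distrib_left)
  also have "\<dots> = card V * closed_walks V E (2 * j)"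
    by (simp add: walks_dot closed_walks_def mult_2)
  finally show ?thesis .
qed

text \<open>Self-adjointness writes the squared norm of A^(j+1) f as the inner product of A^j f and
  A^(j+2) f; Cauchy-Schwarz does the rest.\<close>

lemma sum_pow_sq_log_convex:
  "(\<Sum>u\<in>V. ((nbr_sum E ^^ Suc j) f u)\<^sup>2)\<^sup>2
    \<le> (\<Sum>u\<in>V. ((nbr_sum E ^^ j) f u)\<^sup>2) * (\<Sum>u\<in>V. ((nbr_sum E ^^ Suc (Suc j)) f u)\<^sup>2)"
proof -
  have "(\<Sum>u\<in>V. ((nbr_sum E ^^ Suc j) f u)\<^sup>2)
      = (\<Sum>u\<in>V. (nbr_sum E ^^ j) f u * (nbr_sum E ^^ Suc (Suc j)) f u)"
    using nbr_sum_adjoint[of "(nbr_sum E ^^ j) f" "(nbr_sum E ^^ Suc j) f"]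
    by (simp add: power2_eq_square)
  then show ?thesis
    using Cauchy_Schwarz_ineq_sum[of "(nbr_sum E ^^ j) f" "(nbr_sum E ^^ Suc (Suc j)) f" V] by simp
qed

lemma nbr_sum_const:
  assumes "\<And>v. v \<in> V \<Longrightarrow> card (E `` {v}) = k" "u \<in> V"
  shows "nbr_sum E (\<lambda>_. c) u = k * c"
  using assms by (simp add: nbr_sum_def)

lemma nbr_sum_pow_one:
  assumes "\<And>v. v \<in> V \<Longrightarrow> card (E `` {v}) = k" "u \<in> V"
  shows "(nbr_sum E ^^ j) (\<lambda>_. 1) u = real k ^ j"
  using assms(2)
proof (induction j arbitrary: u)
  case (Suc j)
  have "(nbr_sum E ^^ Suc j) (\<lambda>_. 1) u = nbr_sum E (\<lambda>_. real k ^ j) u"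
    by (auto intro: nbr_sum_cong Suc.IH)
  then show ?case
    using nbr_sum_const[OF assms(1) Suc.prems] by simp
qed simp

lemma sum_walks:
  assumes "\<And>v. v \<in> V \<Longrightarrow> card (E `` {v}) = k" "v \<in> V"
  shows "(\<Sum>u\<in>V. walks E j v u) = real k ^ j"
  using nbr_sum_pow_adjoint[of j "indicator {v}" "\<lambda>_. 1"] sum_indicator_mult[OF assms(2)]
    nbr_sum_pow_one[OF assms] by (simp add: walks_def)

text \<open>The operator is monotone, and the indicator of \<open>v\<close> is at most the constant
  1, which A^j multiplies by \<open>k ^ j\<close> on \<open>V\<close>.\<close>

lemma closed_walks_regular_le:
  assumes "\<And>v. v \<in> V \<Longrightarrow> card (E `` {v}) = k"
  shows "closed_walks V E j \<le> card V * real k ^ j"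
proof -
  have mono: "(nbr_sum E ^^ j) f u \<le> (nbr_sum E ^^ j) g u" if "\<And>v. f v \<le> g v" for f g u
    by (induction j arbitrary: u) (auto intro: that nbr_sum_mono)
  have "walks E j v v \<le> real k ^ j" if "v \<in> V" for v
    using mono[of "indicator {v}" "\<lambda>_. 1" v] nbr_sum_pow_one[OF assms that]
    by (simp add: walks_def indicator_def)
  then show ?thesis
    unfolding closed_walks_def by (rule sum_bounded_above)
qed

end

text \<open>
  The walk counts bound \<open>\<parallel>A\<^sup>j 1\<parallel>\<^sup>2\<close> by a constant times \<open>k\<^bsup>2j\<^esup>\<close>, so log-convexity gives
  \<open>\<parallel>A 1\<parallel> \<le> k \<parallel>1\<parallel>\<close>. Since the average degree is \<open>k\<close>, this is the equality case of Cauchy--Schwarz.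
\<close>

lemma regular_of_closed_walks:
  assumes V: "sym_graph V E" and W: "sym_graph W F"
    and cw: "\<And>j. closed_walks V E j = closed_walks W F j"
    and reg: "\<And>w. w \<in> W \<Longrightarrow> card (F `` {w}) = k" and v: "v \<in> V"
  shows "card (E `` {v}) = k"
proof -
  interpret V: sym_graph V E by fact
  interpret W: sym_graph W F by fact
  have card: "card V = card W"
    using cw[of 0] by (simp add: closed_walks_0)
  define a where "a j = (\<Sum>u\<in>V. ((nbr_sum E ^^ j) (\<lambda>_. 1) u)\<^sup>2)" for j
  let ?d = "\<lambda>u. real (card (E `` {u}))"
  have "a j \<le> (real (card V))\<^sup>2 * (real k ^ 2) ^ j" for j
  proof -
    have "a j \<le> card V * closed_walks W F (2 * j)"
      using V.sum_pow_ones_sq_le[of j] by (simp add: a_def cw)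
    also have "\<dots> \<le> card V * (card V * real k ^ (2 * j))"
      using W.closed_walks_regular_le[OF reg, of "2 * j"] by (intro mult_left_mono) (simp_all add: card)
    finally show ?thesis
      by (simp add: power2_eq_square power_mult mult.assoc)
  qed
  \<comment> \<open>Squared norms are compared, so the growth rate is \<open>k ^ 2\<close>.\<close>
  then have "a 1 \<le> real k ^ 2 * a 0"
    using V.sum_pow_sq_log_convex[of _ "\<lambda>_. 1"]
    by (intro log_convex_growth[of a "(real (card V))\<^sup>2"]) (simp_all add: a_def sum_nonneg)
  then have sq: "(\<Sum>u\<in>V. (?d u)\<^sup>2) \<le> real k ^ 2 * card V"
    by (simp add: a_def nbr_sum_def)
  have lin: "(\<Sum>u\<in>V. ?d u) = card V * real k"
    using cw[of 2] reg by (simp add: V.closed_walks_2 W.closed_walks_2 card)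
  have "(\<Sum>u\<in>V. (?d u - k)\<^sup>2) = (\<Sum>u\<in>V. (?d u)\<^sup>2) - 2 * k * (\<Sum>u\<in>V. ?d u) + card V * real k ^ 2"
    by (simp add: power2_diff sum.distrib sum_subtractf sum_distrib_left mult_ac)
  also have "\<dots> \<le> 0"
    using sq by (simp add: lin power2_eq_square mult.commute mult.left_commute)
  finally have "(\<Sum>u\<in>V. (?d u - k)\<^sup>2) = 0"
    by (simp add: order_antisym sum_nonneg)
  then have "(?d v - k)\<^sup>2 = 0"
    using v V.fin sum_nonneg_eq_0_iff[of V "\<lambda>u. (?d u - k)\<^sup>2"] by simp
  then show ?thesis by simp
qed

text \<open>The squared Frobenius norm of p(A) - b J. The square of p(A) contributes traces, and by
  regularity each row of p(A) sums to p(k), so only closed walk counts, \<open>card V\<close>,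
  \<open>k\<close> and the coefficients enter.\<close>

lemma (in sym_graph) sum_walk_polynomial_sq:
  assumes reg: "\<And>v. v \<in> V \<Longrightarrow> card (E `` {v}) = k"
  shows "(\<Sum>v\<in>V. \<Sum>u\<in>V. ((\<Sum>i\<le>d. c i * walks E i v u) - b)\<^sup>2) =
    (\<Sum>i\<le>d. \<Sum>j\<le>d. c i * c j * closed_walks V E (i + j))
      - card V * (2 * b * (\<Sum>i\<le>d. c i * real k ^ i)) + (real (card V))\<^sup>2 * b\<^sup>2"
proof -
  have row: "(\<Sum>u\<in>V. ((\<Sum>i\<le>d. c i * walks E i v u) - b)\<^sup>2) =
    (\<Sum>i\<le>d. \<Sum>j\<le>d. c i * c j * walks E (i + j) v v)
      - 2 * b * (\<Sum>i\<le>d. c i * real k ^ i) + card V * b\<^sup>2" if v: "v \<in> V" for v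
  proof -
    let ?p = "\<lambda>u. \<Sum>i\<le>d. c i * walks E i v u"
    have "(\<Sum>u\<in>V. (?p u)\<^sup>2) = (\<Sum>u\<in>V. \<Sum>i\<le>d. \<Sum>j\<le>d. c i * c j * (walks E i v u * walks E j v u))"
      by (simp add: power2_eq_square sum_product mult_ac)
    also have "\<dots> = (\<Sum>i\<le>d. \<Sum>j\<le>d. \<Sum>u\<in>V. c i * c j * (walks E i v u * walks E j v u))"
      by (subst sum.swap) (simp add: sum.swap[of _ _ V])
    also have "\<dots> = (\<Sum>i\<le>d. \<Sum>j\<le>d. c i * c j * walks E (i + j) v v)"
      by (simp add: walks_dot[OF v] flip: sum_distrib_left)
    finally have sq: "(\<Sum>u\<in>V. (?p u)\<^sup>2) = \<dots>" .
    have lin: "(\<Sum>u\<in>V. ?p u) = (\<Sum>i\<le>d. c i * real k ^ i)"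
      by (subst sum.swap) (simp add: sum_walks[OF reg v] flip: sum_distrib_left)
    have "(\<Sum>u\<in>V. (?p u - b)\<^sup>2) = (\<Sum>u\<in>V. (?p u)\<^sup>2) - 2 * b * (\<Sum>u\<in>V. ?p u) + card V * b\<^sup>2"
      by (simp add: power2_diff sum.distrib sum_subtractf sum_distrib_left mult_ac)
    then show ?thesis
      by (simp only: sq lin)
  qed
  have "(\<Sum>v\<in>V. \<Sum>i\<le>d. \<Sum>j\<le>d. c i * c j * walks E (i + j) v v)
      = (\<Sum>i\<le>d. \<Sum>j\<le>d. c i * c j * closed_walks V E (i + j))"
    by (subst sum.swap) (simp add: sum.swap[of _ _ V] closed_walks_def sum_distrib_left)
  then show ?thesis
    by (simp add: row sum.distrib sum_subtractf) (simp add: power2_eq_square)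
qed

text \<open>The Frobenius norm of p(A) - b J agrees for both graphs. It vanishes for
  \<open>W\<close>, hence for \<open>V\<close>, and then so does every entry.\<close>

lemma walk_polynomial_transfer:
  assumes V: "sym_graph V E" and W: "sym_graph W F"
    and cw: "\<And>j. closed_walks V E j = closed_walks W F j"
    and regV: "\<And>v. v \<in> V \<Longrightarrow> card (E `` {v}) = k" and regW: "\<And>w. w \<in> W \<Longrightarrow> card (F `` {w}) = k"
    and eq: "\<And>w x. w \<in> W \<Longrightarrow> x \<in> W \<Longrightarrow> (\<Sum>i\<le>d. c i * walks F i w x) = b"
    and uv: "v \<in> V" "u \<in> V"
  shows "(\<Sum>i\<le>d. c i * walks E i v u) = b"
proof -
  interpret V: sym_graph V E by fact
  interpret W: sym_graph W F by fact
  let ?t = "\<lambda>v u. ((\<Sum>i\<le>d. c i * walks E i v u) - b)\<^sup>2"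
  have "card V = card W"
    using cw[of 0] by (simp add: closed_walks_0)
  then have "(\<Sum>v\<in>V. \<Sum>u\<in>V. ?t v u) = (\<Sum>w\<in>W. \<Sum>x\<in>W. ((\<Sum>i\<le>d. c i * walks F i w x) - b)\<^sup>2)"
    by (simp only: V.sum_walk_polynomial_sq[OF regV] W.sum_walk_polynomial_sq[OF regW] cw)
  also have "\<dots> = 0"
    by (simp add: eq)
  finally have "(\<Sum>u\<in>V. ?t v u) = 0"
    using uv V.fin sum_nonneg_eq_0_iff[of V "\<lambda>v. \<Sum>u\<in>V. ?t v u"] by (simp add: sum_nonneg)
  then have "?t v u = 0"
    using uv V.fin sum_nonneg_eq_0_iff[of V "?t v"] by simp
  then show ?thesis by simp
qed

section \<open>Components of the complement\<close>

text \<open>\<open>d\<close> counts the vertices not adjacent to a given vertex, itself included;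
  thus the complement is regular of degree d - 1.\<close>

locale regular_graph = sym_graph +
  fixes k d :: nat
  assumes regular: "v \<in> V \<Longrightarrow> card (E `` {v}) = k"
    and card_V: "card V = k + d"
    and loopfree: "(v, v) \<notin> E"
begin

lemma walks_1: "walks E (Suc 0) v u = of_bool ((u, v) \<in> E)"
proof -
  have "walks E (Suc 0) v u = (\<Sum>w\<in>E `` {u}. if w = v then 1 else 0)"
    unfolding walks_Suc walks_0 nbr_sum_def by (intro sum.cong) (auto simp: indicator_def)
  then show ?thesis
    using finite_nbrs[of u] by simp
qed

lemma sum_walks': "v \<in> V \<Longrightarrow> (\<Sum>u\<in>V. walks E j v u) = real k ^ j"
  by (rule sum_walks[OF regular])

text \<open>
  The constant \<open>(d - k - 1)(d + 1) + k + k\<^sup>2\<close> is the \<open>m\<close> for which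
  \<open>C (C + 1) (C + 2) = m J + A - A\<^sup>3\<close>, where \<open>C = J - 1 - A\<close> is the adjacency operator of the complement;
  the left-hand side vanishes between different components of the complement.
\<close>

lemma walks_outside:
  assumes S: "S \<subseteq> V" "v \<in> S" and adj: "\<And>u x. u \<in> S \<Longrightarrow> x \<in> V - S \<Longrightarrow> (u, x) \<in> E"
    and x: "x \<in> V - S"
  shows "walks E 3 v x = 1 + ((real d - k - 1) * (real d + 1) + k + (real k)\<^sup>2)"
proof -
  have v: "v \<in> V" using S by auto
  \<comment> \<open>A vertex outside \<open>S\<close> is adjacent to all of \<open>S\<close>, so
    there the operator sums a function supported in \<open>S\<close> completely.\<close>
  have supp: "nbr_sum E f x = (\<Sum>u\<in>V. f u)" if f: "\<And>z. z \<in> V - S \<Longrightarrow> f z = 0" and x: "x \<in> V - S" for f x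
    unfolding nbr_sum_conv
  proof (rule sum.cong[OF refl])
    fix u assume "u \<in> V"
    then show "(if (x, u) \<in> E then f u else 0) = f u"
      using f[of u] symD[OF sym_E adj[of u x]] x by auto
  qed
  have w1: "walks E (Suc 0) v x = 1" if "x \<in> V - S" for x
    using that adj[OF S(2) that] symD[OF sym_E] by (auto simp: walks_1)
  have w2: "walks E 2 v x = real k - d" if x: "x \<in> V - S" for x
  proof -
    let ?f = "\<lambda>u. 1 - walks E (Suc 0) v u"
    have "nbr_sum E ?f x = (\<Sum>u\<in>V. ?f u)"
      using w1 by (intro supp) (use x in auto)
    moreover have "nbr_sum E ?f x = k - walks E 2 v x"
      using nbr_sum_const[OF regular, of x 1] x
      by (simp add: nbr_sum_diff walks_Suc[symmetric] numeral_2_eq_2)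
    moreover have "(\<Sum>u\<in>V. ?f u) = d"
      using sum_walks'[OF v, of 1] by (simp add: sum_subtractf card_V)
    ultimately show ?thesis by simp
  qed
  \<comment> \<open>The constant makes \<open>?f\<close> vanish outside \<open>S\<close>, where the
    two walk counts are \<open>1\<close> and \<open>real k - d\<close>.\<close>
  let ?f = "\<lambda>u. (real d - k - 1) + (walks E (Suc 0) v u + walks E 2 v u)"
  have "nbr_sum E ?f x = (\<Sum>u\<in>V. ?f u)"
    using w1 w2 by (intro supp) (use x in auto)
  moreover have "nbr_sum E ?f x = (real d - k - 1) * k + (walks E 2 v x + walks E 3 v x)"
    using nbr_sum_const[OF regular, of x] x
    by (simp add: nbr_sum_add walks_Suc[symmetric] numeral_2_eq_2 numeral_3_eq_3)
  moreover have "(\<Sum>u\<in>V. ?f u) = (real d - k - 1) * (k + d) + (k + (real k)\<^sup>2)"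
    using sum_walks'[OF v, of 1] sum_walks'[OF v, of 2] by (simp add: sum.distrib card_V)
  ultimately show ?thesis
    using w2[OF x] by (simp add: algebra_simps power2_eq_square)
qed

text \<open>With C the adjacency operator of the complement, row \<open>v\<close> of C (C + 1) (C +
  2) vanishes outside \<open>S\<close> and is constant on \<open>S\<close>. Its total is (d - 1) d
  (d + 1), because C has row sums d - 1.\<close>

lemma class_size_walks:
  assumes S: "S \<subseteq> V" "v \<in> S" and adj: "\<And>u x. u \<in> S \<Longrightarrow> x \<in> V - S \<Longrightarrow> (u, x) \<in> E"
    and const: "\<And>u. u \<in> S \<Longrightarrow> walks E 3 v u - walks E (Suc 0) v u = walks E 3 v v"
  shows "card S * ((real d - k - 1) * (real d + 1) + k + (real k)\<^sup>2 - walks E 3 v v)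
    = (real d - 1) * d * (real d + 1)"
proof -
  let ?m = "(real d - k - 1) * (real d + 1) + k + (real k)\<^sup>2"
  let ?w = "\<lambda>u. ?m - (walks E 3 v u - walks E (Suc 0) v u)"
  have v: "v \<in> V" using S by auto
  have "(\<Sum>u\<in>V. ?w u) = (\<Sum>u\<in>S. ?w u)"
  proof (rule sum.mono_neutral_right[OF fin S(1)], rule ballI)
    fix x assume x: "x \<in> V - S"
    have "walks E (Suc 0) v x = 1"
      using adj[OF S(2) x] symD[OF sym_E] by (auto simp: walks_1)
    then show "?w x = 0"
      using walks_outside[OF S adj x] by simp
  qed
  also have "\<dots> = card S * (?m - walks E 3 v v)"
    by (simp add: const)
  finally have "card S * (?m - walks E 3 v v) = (\<Sum>u\<in>V. ?w u)" ..
  also have "\<dots> = ?m * (k + d) - (real k ^ 3 - k)"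
    using sum_walks'[OF v, of 1] sum_walks'[OF v, of 3] by (simp add: sum_subtractf card_V)
  also have "\<dots> = (real d - 1) * d * (real d + 1)"
    by (simp add: algebra_simps power2_eq_square power3_eq_cube)
  finally show ?thesis .
qed

text \<open>The hypothesis says (J - A) y = d y, that is, \<open>y\<close> is an eigenfunction of
  the complement whose eigenvalue is the degree d - 1.\<close>

lemma eigenfunction_const_on_nonadjacent:
  fixes y :: "'a \<Rightarrow> real"
  assumes eq: "\<And>u. u \<in> V \<Longrightarrow> nbr_sum E y u + real d * y u = (\<Sum>x\<in>V. y x)"
    and ux: "u \<in> V" "x \<in> V" "(u, x) \<notin> E"
  shows "y u = y x"
proof -
  let ?T = "\<Sum>x\<in>V. y x" and ?Q = "\<Sum>x\<in>V. (y x)\<^sup>2"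
  \<comment> \<open>the Dirichlet energy of \<open>y\<close> on the complement is zero\<close>
  let ?e = "\<lambda>u x. if (u, x) \<in> E then 0 else (y u - y x)\<^sup>2"
  have row: "(\<Sum>x\<in>V. ?e u x) = d * (y u)\<^sup>2 + ?Q - nbr_sum E (\<lambda>x. (y x)\<^sup>2) u
      - 2 * (y u * (?T - nbr_sum E y u))" if u: "u \<in> V" for u
  proof -
    have "(\<Sum>x\<in>V. ?e u x) = (\<Sum>x\<in>V. (y u - y x)\<^sup>2) - nbr_sum E (\<lambda>x. (y u - y x)\<^sup>2) u"
      unfolding nbr_sum_conv sum_subtractf[symmetric] by (rule sum.cong) auto
    also have "(\<Sum>x\<in>V. (y u - y x)\<^sup>2) = (k + d) * (y u)\<^sup>2 - 2 * (y u * ?T) + ?Q"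
      by (simp add: power2_diff sum.distrib sum_subtractf sum_distrib_left card_V mult_ac)
    also have "nbr_sum E (\<lambda>x. (y u - y x)\<^sup>2) u
        = nbr_sum E (\<lambda>x. (y u)\<^sup>2 + (y x)\<^sup>2 - (2 * y u) * y x) u"
      by (simp add: power2_diff)
    also have "\<dots> = k * (y u)\<^sup>2 + nbr_sum E (\<lambda>x. (y x)\<^sup>2) u - 2 * (y u * nbr_sum E y u)"
      unfolding nbr_sum_diff nbr_sum_add nbr_sum_mult using nbr_sum_const[OF regular u] by simp
    finally show ?thesis
      by (simp add: algebra_simps)
  qed
  have Q: "(\<Sum>u\<in>V. nbr_sum E (\<lambda>x. (y x)\<^sup>2) u) = k * ?Q"
    by (simp add: sum_nbr_sum regular mult.commute flip: sum_distrib_left)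
  have "(\<Sum>u\<in>V. \<Sum>x\<in>V. ?e u x) = (\<Sum>u\<in>V. d * (y u)\<^sup>2 + ?Q - nbr_sum E (\<lambda>x. (y x)\<^sup>2) u
      - 2 * d * (y u)\<^sup>2)"
  proof (rule sum.cong[OF refl])
    fix u assume u: "u \<in> V"
    have "?T - nbr_sum E y u = d * y u"
      using eq[OF u] by simp
    then show "(\<Sum>x\<in>V. ?e u x) = d * (y u)\<^sup>2 + ?Q - nbr_sum E (\<lambda>x. (y x)\<^sup>2) u - 2 * d * (y u)\<^sup>2"
      by (simp only: row[OF u]) (simp add: power2_eq_square)
  qed
  also have "\<dots> = d * ?Q + card V * ?Q - k * ?Q - 2 * d * ?Q"
    by (simp add: sum.distrib sum_subtractf Q flip: sum_distrib_left)
  also have "\<dots> = 0"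
    by (simp add: card_V algebra_simps)
  finally have "(\<Sum>x\<in>V. ?e u x) = 0"
    using ux fin sum_nonneg_eq_0_iff[of V "\<lambda>u. \<Sum>x\<in>V. ?e u x"] by (simp add: sum_nonneg)
  then have "\<forall>x\<in>V. ?e u x = 0"
    by (subst (asm) sum_nonneg_eq_0_iff[OF fin]) auto
  from bspec[OF this ux(2)] show ?thesis
    using ux(3) by simp
qed

text \<open>The left-hand side is A (A - 1) (A + 1) (A + d), so the eigenvalues on functions
  orthogonal to the constants are confined to 0, 1, -1 and -d. Grouped as (A + d) (A^3 - A), it says
  that J - A multiplies each column of A^3 - A by \<open>d\<close>.\<close>

definition walk4_identity :: bool where
  "walk4_identity \<longleftrightarrow> (\<forall>v\<in>V. \<forall>u\<in>V. walks E 4 v u + d * walks E 3 v u - walks E 2 v u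
     - d * walks E (Suc 0) v u = real k ^ 3 - k)"

lemma walks_const_on_nonadjacent:
  assumes id: walk4_identity and v: "v \<in> V" and ux: "u \<in> V" "x \<in> V" "(u, x) \<notin> E"
  shows "walks E 3 v u - walks E (Suc 0) v u = walks E 3 v x - walks E (Suc 0) v x"
proof (rule eigenfunction_const_on_nonadjacent[of "\<lambda>u. walks E 3 v u - walks E (Suc 0) v u", OF _ ux])
  fix u assume u: "u \<in> V"
  have T: "(\<Sum>x\<in>V. walks E 3 v x - walks E (Suc 0) v x) = real k ^ 3 - k"
    using sum_walks'[OF v, of 1] sum_walks'[OF v, of 3] by (simp add: sum_subtractf)
  have L: "nbr_sum E (\<lambda>u. walks E 3 v u - walks E (Suc 0) v u) u = walks E 4 v u - walks E 2 v u"
    by (simp add: nbr_sum_diff walks_Suc[symmetric] numeral_2_eq_2 eval_nat_numeral)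
  have "walks E 4 v u + d * walks E 3 v u - walks E 2 v u - d * walks E (Suc 0) v u = real k ^ 3 - k"
    using id u v by (simp add: walk4_identity_def)
  then show "nbr_sum E (\<lambda>u. walks E 3 v u - walks E (Suc 0) v u) u
      + d * (walks E 3 v u - walks E (Suc 0) v u) = (\<Sum>x\<in>V. walks E 3 v x - walks E (Suc 0) v x)"
    unfolding T L by (simp add: algebra_simps)
qed

text \<open>
  The column \<open>g\<close> of \<open>(A\<^sup>2 - 1)(A + d) - (k\<^sup>2 - 1) J\<close> at \<open>v\<close> lies in the
  kernel of \<open>A\<close> and is orthogonal to the constants, so \<open>\<parallel>g\<parallel>\<^sup>2 = - d g(v)\<close>.
\<close>

lemma closed_3_walks_le:
  assumes id: walk4_identity and v: "v \<in> V" and d: "d > 0"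
  shows "walks E 3 v v \<le> (real k)\<^sup>2 - d * k + d - 1"
proof -
  let ?g = "\<lambda>u. walks E 3 v u + d * walks E 2 v u - walks E (Suc 0) v u - d * walks E 0 v u
    - ((real k)\<^sup>2 - 1)"
  have Lg: "nbr_sum E ?g u = 0" if u: "u \<in> V" for u
  proof -
    have "nbr_sum E ?g u = walks E 4 v u + d * walks E 3 v u - walks E 2 v u
       - d * walks E (Suc 0) v u - k * ((real k)\<^sup>2 - 1)"
      using nbr_sum_const[OF regular u, of "(real k)\<^sup>2 - 1"]
      unfolding nbr_sum_diff[of E _ "\<lambda>_. (real k)\<^sup>2 - 1"]
      unfolding nbr_sum_diff[of E _ "walks E j v" for j] nbr_sum_diff[of E _ "\<lambda>u. d * walks E 0 v u"]
        nbr_sum_add nbr_sum_mult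
      by (simp add: walks_Suc eval_nat_numeral)
    then show ?thesis
      using id u v by (simp add: walk4_identity_def algebra_simps power2_eq_square power3_eq_cube)
  qed
  have orth: "(\<Sum>u\<in>V. ?g u * walks E (Suc j) v u) = 0" for j
    unfolding walks_Suc[of E j] nbr_sum_adjoint[symmetric] using Lg by simp
  have Tg: "(\<Sum>u\<in>V. ?g u) = 0"
  proof -
    have "(\<Sum>u\<in>V. ?g u) = real k ^ 3 + d * real k ^ 2 - k - d - (k + d) * ((real k)\<^sup>2 - 1)"
      using sum_walks'[OF v, of 0] sum_walks'[OF v, of 1] sum_walks'[OF v, of 2] sum_walks'[OF v, of 3]
      by (simp add: sum.distrib sum_subtractf card_V flip: sum_distrib_left)
    then show ?thesis
      by (simp add: algebra_simps power2_eq_square power3_eq_cube)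
  qed
  have "0 \<le> (\<Sum>u\<in>V. ?g u * ?g u)"
    by (simp add: sum_nonneg)
  also have "\<dots> = (\<Sum>u\<in>V. ?g u * walks E 3 v u) + d * (\<Sum>u\<in>V. ?g u * walks E 2 v u)
      - (\<Sum>u\<in>V. ?g u * walks E (Suc 0) v u) - d * (\<Sum>u\<in>V. ?g u * walks E 0 v u)
      - ((real k)\<^sup>2 - 1) * (\<Sum>u\<in>V. ?g u)"
    unfolding sum_distrib_left sum.distrib[symmetric] sum_subtractf[symmetric]
    by (rule sum.cong) (simp_all add: algebra_simps)
  \<comment> \<open>Only the unit vector part of \<open>?g\<close> survives: \<open>?g\<close> is
    orthogonal to the constants and, lying in the kernel of A, to every column of a positive power
    of A.\<close>
  also have "\<dots> = - d * (\<Sum>u\<in>V. ?g u * walks E 0 v u)"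
    unfolding Tg using orth[of 0] orth[of 1] orth[of 2] by (simp add: eval_nat_numeral)
  also have "(\<Sum>u\<in>V. ?g u * walks E 0 v u) = ?g v"
    unfolding walks_0 using sum_indicator_mult[OF v, of ?g] by (simp add: walks_0 mult.commute)
  finally have "?g v \<le> 0"
    using d by (simp add: zero_le_mult_iff mult_le_0_iff)
  then show ?thesis
    using walks_2[OF v] regular[OF v] loopfree by (simp add: walks_1 walks_0 algebra_simps)
qed

end

section \<open>Graphs with matched classes\<close>

text \<open>Class \<open>0\<close> is an independent set, every other class induces a perfect matching \<open>\<sigma>\<close>, and distinct
  classes are completely joined.\<close>

locale matched_classes =
  fixes V :: "'a set" and E :: "'a rel" and \<kappa> :: "'a \<Rightarrow> nat" and \<sigma> :: "'a \<Rightarrow> 'a" and h r :: nat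
  assumes finite_V: "finite V"
    and arc_iff: "(u, w) \<in> E \<longleftrightarrow> u \<in> V \<and> w \<in> V \<and> (\<kappa> u \<noteq> \<kappa> w \<or> \<kappa> u \<noteq> 0 \<and> w = \<sigma> u)"
    and mate: "u \<in> V \<Longrightarrow> \<kappa> u \<noteq> 0 \<Longrightarrow> \<sigma> u \<in> V \<and> \<kappa> (\<sigma> u) = \<kappa> u \<and> \<sigma> (\<sigma> u) = u \<and> \<sigma> u \<noteq> u"
    and class_le: "u \<in> V \<Longrightarrow> \<kappa> u \<le> r"
    and card_class0: "card {u \<in> V. \<kappa> u = 0} = h - 1"
    and card_class: "i \<in> {1..r} \<Longrightarrow> card {u \<in> V. \<kappa> u = i} = h"
    and h: "h \<ge> 2"
begin

lemma finite_class: "finite {u \<in> V. P u}"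
  using finite_V by simp

lemma card_classes: "card {u \<in> V. \<kappa> u \<noteq> 0} = r * h"
proof -
  have "{u \<in> V. \<kappa> u \<noteq> 0} = (\<Union>i\<in>{1..r}. {u \<in> V. \<kappa> u = i})"
    using class_le by (auto simp: Suc_le_eq)
  also have "card \<dots> = (\<Sum>i\<in>{1..r}. card {u \<in> V. \<kappa> u = i})"
    by (rule card_UN_disjoint) (use finite_class in auto)
  also have "\<dots> = r * h"
    using card_class by simp
  finally show ?thesis .
qed

lemma card_total: "card V = r * h + (h - 1)"
proof -
  have "{u \<in> V. \<kappa> u \<noteq> 0} = V - {u \<in> V. \<kappa> u = 0}"
    by auto
  then have "card {u \<in> V. \<kappa> u \<noteq> 0} = card V - card {u \<in> V. \<kappa> u = 0}"
    using finite_class by (simp add: card_Diff_subset)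
  moreover have "card {u \<in> V. \<kappa> u = 0} \<le> card V"
    using finite_V by (intro card_mono) auto
  ultimately show ?thesis
    using card_classes card_class0 by linarith
qed

text \<open>A vertex of class 0 sees exactly the other classes. Any other vertex loses the
  \<open>h\<close> members of its class but regains its mate: r h + (h - 1) - h + 1 = r h.\<close>

lemma degree:
  assumes u: "u \<in> V"
  shows "card (E `` {u}) = r * h"
proof (cases "\<kappa> u = 0")
  case True
  then have "E `` {u} = {w \<in> V. \<kappa> w \<noteq> 0}"
    using u by (auto simp: arc_iff[of u])
  then show ?thesis
    by (simp only: card_classes)
next
  case False
  let ?S = "{w \<in> V. \<kappa> w = \<kappa> u}"
  have "E `` {u} = insert (\<sigma> u) (V - ?S)"
    using u mate[OF u False] False by (auto simp: arc_iff[of u])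
  moreover have "\<sigma> u \<notin> V - ?S"
    using mate[OF u False] by simp
  ultimately have "card (E `` {u}) = Suc (card (V - ?S))"
    using finite_V by simp
  also have "card (V - ?S) = card V - card ?S"
    using finite_class by (intro card_Diff_subset) auto
  also have "card ?S = h"
    using card_class[of "\<kappa> u"] class_le[OF u] False by simp
  finally show ?thesis
    using h class_le[OF u] False by (simp add: card_total)
qed

sublocale regular_graph V E "r * h" "h - 1"
proof unfold_locales
  show "sym E"
  proof (rule symI)
    fix u w assume "(u, w) \<in> E"
    then show "(w, u) \<in> E"
      using mate[of u] unfolding arc_iff[of u w] arc_iff[of w u] by auto
  qed
  show "(v, v) \<notin> E" for v
    using mate[of v] by (auto simp: arc_iff[of v v])
  show "E \<subseteq> V \<times> V"
    using arc_iff by auto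
qed (simp_all add: finite_V degree card_total)

lemma nbr_sum_classes:
  assumes u: "u \<in> V"
  shows "nbr_sum E f u = (\<Sum>x\<in>V. f x) - (\<Sum>x | x \<in> V \<and> \<kappa> x = \<kappa> u. f x)
    + (if \<kappa> u = 0 then 0 else f (\<sigma> u))"
proof -
  let ?S = "{x \<in> V. \<kappa> x = \<kappa> u}"
  have split: "(\<Sum>x\<in>V. f x) - (\<Sum>x\<in>?S. f x) = (\<Sum>x\<in>V - ?S. f x)"
    using finite_V by (subst sum_diff) auto
  show ?thesis
  proof (cases "\<kappa> u = 0")
    case True
    then have "E `` {u} = V - ?S"
      using u by (auto simp: arc_iff[of u])
    then show ?thesis
      using True split by (simp add: nbr_sum_def)
  next
    case False
    have "E `` {u} = insert (\<sigma> u) (V - ?S)"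
      using u mate[OF u False] False by (auto simp: arc_iff[of u])
    moreover have "\<sigma> u \<notin> V - ?S"
      using mate[OF u False] by simp
    ultimately show ?thesis
      using False split finite_V by (simp add: nbr_sum_def)
  qed
qed

text \<open>Applying A gives a class constant plus, outside class 0, the value at the mate. Two
  applications return to the vertex itself, so there A^3 f - A f is a class constant; on class 0
  both terms are.\<close>

lemma walks_const_on_classes:
  assumes ux: "u \<in> V" "x \<in> V" "\<kappa> u = \<kappa> x"
  shows "walks E 3 v u - walks E (Suc 0) v u = walks E 3 v x - walks E (Suc 0) v x"
proof -
  define c where "c j i = (\<Sum>x\<in>V. walks E j v x) - (\<Sum>x | x \<in> V \<and> \<kappa> x = i. walks E j v x)" for j i
  have step: "walks E (Suc j) v u = c j (\<kappa> u) + (if \<kappa> u = 0 then 0 else walks E j v (\<sigma> u))"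
    if "u \<in> V" for j u
    unfolding walks_Suc c_def by (rule nbr_sum_classes[OF that])
  have "walks E 3 v u - walks E (Suc 0) v u
      = (if \<kappa> u = 0 then c 2 0 - c 0 0 else c 2 (\<kappa> u) + c 1 (\<kappa> u))" if u: "u \<in> V" for u
    using mate[OF u] step[OF u, of 0] step[OF u, of 1] step[OF u, of 2]
      step[of "\<sigma> u" 0] step[of "\<sigma> u" 1]
    by (auto simp: eval_nat_numeral)
  then show ?thesis
    using ux by simp
qed

lemma walk4: walk4_identity
  unfolding walk4_identity_def
proof (intro ballI)
  fix v u assume v: "v \<in> V" and u: "u \<in> V"
  let ?y = "\<lambda>u. walks E 3 v u - walks E (Suc 0) v u"
  have "nbr_sum E ?y u = walks E 4 v u - walks E 2 v u"
    by (simp add: nbr_sum_diff walks_Suc eval_nat_numeral)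
  moreover have "(\<Sum>x\<in>V. ?y x) = real (r * h) ^ 3 - real (r * h)"
    using sum_walks'[OF v, of 1] sum_walks'[OF v, of 3] by (simp add: sum_subtractf)
  moreover have "(\<Sum>x | x \<in> V \<and> \<kappa> x = \<kappa> u. ?y x) = card {x \<in> V. \<kappa> x = \<kappa> u} * ?y u"
    using walks_const_on_classes[OF _ u, of _ v] by simp
  \<comment> \<open>A class of size \<open>h\<close> loses one copy of \<open>?y u\<close> to the
    mate term, so every class ends up with the factor \<open>h - 1\<close>.\<close>
  moreover have "card {x \<in> V. \<kappa> x = \<kappa> u} * ?y u
      = (h - 1) * ?y u + (if \<kappa> u = 0 then 0 else ?y (\<sigma> u))"
  proof (cases "\<kappa> u = 0")
    case False
    then have "?y (\<sigma> u) = ?y u"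
      using mate[OF u] walks_const_on_classes[of "\<sigma> u" u v] u by simp
    then show ?thesis
      using False card_class[of "\<kappa> u"] class_le[OF u] h by (simp add: of_nat_diff algebra_simps)
  qed (simp add: card_class0)
  ultimately show "walks E 4 v u + real (h - 1) * walks E 3 v u - walks E 2 v u
      - real (h - 1) * walks E (Suc 0) v u = real (r * h) ^ 3 - real (r * h)"
    using nbr_sum_classes[OF u, of ?y] by (simp add: algebra_simps)
qed

lemma class_closed_3_walks:
  assumes v: "v \<in> V"
  shows "card {u \<in> V. \<kappa> u = \<kappa> v} * ((real (h - 1) - real (r * h) - 1) * (real (h - 1) + 1)
      + real (r * h) + (real (r * h))\<^sup>2 - walks E 3 v v) = (real (h - 1) - 1) * real (h - 1) * (real (h - 1) + 1)"
proof (rule class_size_walks)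
  fix u assume "u \<in> {u \<in> V. \<kappa> u = \<kappa> v}"
  then show "walks E 3 v u - walks E (Suc 0) v u = walks E 3 v v"
    using walks_const_on_classes[of u v v] v loopfree by (simp add: walks_1)
qed (use v arc_iff in auto)

text \<open>With d = h - 1, \<open>?w\<close> is (d - 1) d at every vertex, plus d - 1 at each of
  the d vertices of class 0. Read backwards, this total reveals how many vertices lie in small
  components.\<close>

lemma sum_closed_3_walks:
  "card V * ((real (h - 1) - real (r * h) - 1) * (real (h - 1) + 1) + real (r * h) + (real (r * h))\<^sup>2)
    - closed_walks V E 3 = (real (h - 1) - 1) * real (h - 1) * (card V + 1)"
proof -
  let ?d = "real (h - 1)"
  let ?w = "\<lambda>v. (?d - real (r * h) - 1) * (?d + 1) + real (r * h) + (real (r * h))\<^sup>2 - walks E 3 v v"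
  have d: "?d > 0" "real h = ?d + 1"
    using h by (simp_all add: of_nat_diff)
  have w: "?w v = (if \<kappa> v = 0 then (?d - 1) * (?d + 1) else (?d - 1) * ?d)" if v: "v \<in> V" for v
  proof (cases "\<kappa> v = 0")
    case True
    then have "?d * ?w v = ?d * ((?d - 1) * (?d + 1))"
      using class_closed_3_walks[OF v] by (simp only: card_class0) (simp add: mult_ac)
    then show ?thesis using True d(1) by simp
  next
    case False
    then have "card {u \<in> V. \<kappa> u = \<kappa> v} = h"
      using card_class[of "\<kappa> v"] class_le[OF v] by simp
    then have "(?d + 1) * ?w v = (?d + 1) * ((?d - 1) * ?d)"
      using class_closed_3_walks[OF v] by (simp only: d(2)) (simp add: mult_ac)
    then show ?thesis using False d(1) by simp
  qed
  have "(\<Sum>v\<in>V. ?w v) = (\<Sum>v\<in>V. (?d - 1) * ?d + (if \<kappa> v = 0 then ?d - 1 else 0))"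
  proof (rule sum.cong[OF refl])
    fix v assume "v \<in> V"
    then show "?w v = (?d - 1) * ?d + (if \<kappa> v = 0 then ?d - 1 else 0)"
      by (simp only: w) (simp add: algebra_simps)
  qed
  also have "\<dots> = card V * ((?d - 1) * ?d) + card {v \<in> V. \<kappa> v = 0} * (?d - 1)"
    using finite_V by (simp add: sum.distrib flip: sum.inter_filter)
  also have "\<dots> = (?d - 1) * ?d * (card V + 1)"
    by (simp add: card_class0 algebra_simps)
  finally show ?thesis
    by (simp add: sum_subtractf closed_walks_def)
qed

end

section \<open>Coordinates on partitions and recovery of the classes\<close>

text \<open>Classes are numbered, and so are the elements inside each; injectivity and counting give
  surjectivity. It serves both for the components of the complement and, with blocks of size 2, for
  the matched pairs.\<close>

lemma uniform_partition_coordinates: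
  assumes Q: "equiv A Q" and fin: "finite A" and card_Q: "\<And>u. u \<in> A \<Longrightarrow> card (Q `` {u}) = c"
    and card_A: "card A = m * c" and c: "c > 0"
  obtains f where "bij_betw f A ({1..m} \<times> {..<c})"
    and "\<And>u v. u \<in> A \<Longrightarrow> v \<in> A \<Longrightarrow> fst (f u) = fst (f v) \<longleftrightarrow> (u, v) \<in> Q"
proof -
  have "c * card (A // Q) = card (\<Union>(A // Q))"
  proof (rule card_partition)
    show "finite (A // Q)"
      using fin equiv_type[OF Q] by (rule finite_quotient)
    show "finite (\<Union>(A // Q))"
      using fin by (simp add: Union_quotient[OF Q])
    show "card B = c" if "B \<in> A // Q" for B
      using that card_Q by (auto elim: quotientE)
    show "B \<inter> C = {}" if "B \<in> A // Q" "C \<in> A // Q" "B \<noteq> C" for B C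
      using quotient_disj[OF Q that(1,2)] that(3) by blast
  qed
  then have "card (A // Q) = card {1..m}"
    using c card_A by (simp add: Union_quotient[OF Q])
  then obtain g where g: "bij_betw g (A // Q) {1..m}"
    using finite_same_card_bij[OF finite_quotient[OF fin equiv_type[OF Q]] finite_atLeastAtMost] by blast
  have "\<exists>e. bij_betw e B {..<c}" if "B \<in> A // Q" for B
  proof (rule finite_same_card_bij)
    show "finite B"
      using that finite_equiv_class[OF fin equiv_type[OF Q]] by simp
    show "card B = card {..<c}"
      using that card_Q by (auto elim: quotientE)
  qed simp
  then obtain e where e: "\<And>B. B \<in> A // Q \<Longrightarrow> bij_betw (e B) B {..<c}"
    by metis
  define f where "f u = (g (Q `` {u}), e (Q `` {u}) u)" for u
  have cls: "Q `` {u} \<in> A // Q" "u \<in> Q `` {u}" if "u \<in> A" for u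
    using that quotientI[of u A Q] equiv_class_self[OF Q] by auto
  have same: "fst (f u) = fst (f v) \<longleftrightarrow> (u, v) \<in> Q" if "u \<in> A" "v \<in> A" for u v
    using bij_betw_imp_inj_on[OF g] cls that eq_equiv_class_iff[OF Q that]
    by (auto simp: f_def inj_on_eq_iff)
  have inj: "inj_on f A"
  proof (rule inj_onI)
    fix u v assume uv: "u \<in> A" "v \<in> A" "f u = f v"
    then have "(u, v) \<in> Q" using same[of u v] by simp
    then have eq: "Q `` {u} = Q `` {v}"
      using equiv_class_eq[OF Q] by blast
    have "e (Q `` {v}) u = e (Q `` {v}) v"
      using uv(3) by (simp add: f_def eq)
    then show "u = v"
      using bij_betw_imp_inj_on[OF e[OF cls(1)[OF uv(2)]]] cls(2)[OF uv(1)] cls(2)[OF uv(2)]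
      by (simp add: eq inj_on_eq_iff)
  qed
  have "f ` A \<subseteq> {1..m} \<times> {..<c}"
    using bij_betwE[OF g] bij_betwE[OF e] cls by (fastforce simp: f_def)
  then have "f ` A = {1..m} \<times> {..<c}"
    using card_image[OF inj] by (intro card_subset_eq) (simp_all add: card_A card_cartesian_product)
  then show ?thesis
    using that[of f] same inj by (simp add: bij_betw_def)
qed

text \<open>Arcs are vertex pairs, so the vertex bijection determines the arc map
  \<open>map_prod f f\<close>.\<close>

lemma digraph_isoI:
  assumes Y: "pair_wf_digraph Y" and bij: "bij_betw f (pverts Y) (pverts X)"
    and X: "parcs X \<subseteq> pverts X \<times> pverts X"
    and arcs: "\<And>u v. u \<in> pverts Y \<Longrightarrow> v \<in> pverts Y \<Longrightarrow> (u, v) \<in> parcs Y \<longleftrightarrow> (f u, f v) \<in> parcs X"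
  shows "digraph_iso (with_proj Y) (with_proj X)"
proof -
  interpret Y: pair_wf_digraph Y by fact
  let ?i = "\<lparr>iso_verts = f, iso_arcs = map_prod f f, iso_head = snd, iso_tail = fst\<rparr>"
  have sub: "parcs Y \<subseteq> pverts Y \<times> pverts Y"
    by (auto dest: Y.in_arcsD1 Y.in_arcsD2)
  have inj: "inj_on f (pverts Y)" and img: "f ` pverts Y = pverts X"
    using bij by (auto simp: bij_betw_def)
  have "inj_on (map_prod f f) (parcs Y)"
    using map_prod_inj_on[OF inj inj] sub by (rule inj_on_subset)
  then have "Y.digraph_isomorphism ?i"
    using inj by (simp add: Y.digraph_isomorphism_def Y.wf_digraph_axioms)
  moreover have "parcs X = map_prod f f ` parcs Y"
  proof (intro equalityI subsetI)
    fix a assume a: "a \<in> parcs X"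
    then obtain u v where "a = (f u, f v)" "u \<in> pverts Y" "v \<in> pverts Y"
      using X img by (cases a) (blast elim!: imageE)
    then show "a \<in> map_prod f f ` parcs Y"
      using a arcs by (auto intro!: image_eqI[of _ _ "(u, v)"])
  qed (use sub arcs in auto)
  then have "with_proj X = app_iso ?i (with_proj Y)"
    by (simp add: app_iso_def with_proj_def img)
  ultimately show ?thesis
    unfolding digraph_iso_def by blast
qed

text \<open>\<open>cw3\<close> is the total from \<open>sum_closed_3_walks\<close>, and
  \<open>d \<ge> 2\<close> makes the factor d - 1 cancellable.\<close>

lemma (in regular_graph) matched_classes_if_walks:
  assumes id: walk4_identity and d: "d \<ge> 2" and k: "k = r * (d + 1)"
    and cw3: "card V * ((real d - k - 1) * (real d + 1) + k + (real k)\<^sup>2) - closed_walks V E 3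
      = (real d - 1) * d * (card V + 1)"
  shows "\<exists>\<kappa> \<sigma>. matched_classes V E \<kappa> \<sigma> (d + 1) r"
proof -
  \<comment> \<open>\<open>R\<close> contains the diagonal, as there are no loops. Hence its
    transitive closure is reflexive on \<open>V\<close>, and each \<open>R\<close>-neighbourhood of
    a vertex has \<open>d\<close> elements.\<close>
  define R where "R = {(u, x). u \<in> V \<and> x \<in> V \<and> (u, x) \<notin> E}"
  have symR: "sym R"
    using symD[OF sym_E] by (auto simp: R_def sym_def)
  define Q where "Q = R\<^sup>+"
  have RQ: "(u, x) \<in> Q" if "(u, x) \<in> R" for u x
    using that by (auto simp: Q_def)
  have Q_sub: "Q \<subseteq> V \<times> V"
    unfolding Q_def by (rule trancl_subset_Sigma) (auto simp: R_def)
  have symQ: "sym Q" unfolding Q_def using symR by (rule sym_trancl)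
  have transQ: "trans Q" unfolding Q_def by (rule trans_trancl)
  have equiv: "equiv V Q"
  proof (rule equivI)
    show "refl_on V Q"
      using loopfree by (intro refl_onI) (auto simp: R_def intro!: RQ)
    show "sym Q" by (rule symQ)
    show "trans Q" by (rule transQ)
    show "Q \<subseteq> V \<times> V" by (rule Q_sub)
  qed
  have fin_Q: "finite (Q `` {v})" for v
    using Q_sub fin by (auto intro: finite_subset)
  have card_R: "card (R `` {v}) = d" if v: "v \<in> V" for v
  proof -
    have "R `` {v} = V - E `` {v}"
      using v by (auto simp: R_def)
    then show ?thesis
      using card_Diff_subset[OF finite_nbrs nbrs_subset] by (simp add: regular[OF v] card_V)
  qed
  have R_sub_Q: "R `` {v} \<subseteq> Q `` {v}" for v
    using RQ by auto
  have Q_cls: "Q `` {u} = Q `` {v}" if "(u, v) \<in> Q" for u v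
    using equiv_class_eq[OF equiv that] .
  have Q_self: "v \<in> Q `` {v}" if "v \<in> V" for v
    using equiv_class_self[OF equiv that] .
  have Q_outside: "(u, x) \<in> E" if "u \<in> V" "x \<in> V" "(u, x) \<notin> Q" for u x
    using that RQ by (auto simp: R_def)
  define w where "w v = (real d - k - 1) * (real d + 1) + k + (real k)\<^sup>2 - walks E 3 v v" for v
  have size: "card (Q `` {v}) * w v = (real d - 1) * d * (real d + 1)" if v: "v \<in> V" for v
    unfolding w_def
  proof (rule class_size_walks)
    show "Q `` {v} \<subseteq> V" using Q_sub by auto
    show "v \<in> Q `` {v}" using Q_self[OF v] .
    show "(u, x) \<in> E" if "u \<in> Q `` {v}" "x \<in> V - Q `` {v}" for u x
    proof (rule Q_outside)
      show "u \<in> V" "x \<in> V" using that Q_sub by auto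
      show "(u, x) \<notin> Q" using that Q_cls[of v u] by auto
    qed
    show "walks E 3 v u - walks E (Suc 0) v u = walks E 3 v v" if "u \<in> Q `` {v}" for u
    proof -
      have "(v, u) \<in> R\<^sup>+" using that by (simp add: Q_def)
      then show ?thesis
      proof (induction rule: trancl_induct)
        case (base u)
        then show ?case
          using walks_const_on_nonadjacent[OF id v, of v u] v loopfree by (simp add: R_def walks_1)
      next
        case (step u x)
        then show ?case
          using walks_const_on_nonadjacent[OF id v, of u x] by (simp add: R_def)
      qed
    qed
  qed
  have d_pos: "real d - 1 > 0" "real d > 0" using d by simp_all
  \<comment> \<open>\<open>closed_3_walks_le\<close> bounds \<open>w v\<close> below by (d - 1) d,
    hence the class size above by d + 1; the \<open>R\<close>-neighbourhood gives the lower bound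
    d.\<close>
  have card_Q: "card (Q `` {v}) = d \<or> card (Q `` {v}) = d + 1" if v: "v \<in> V" for v
  proof -
    have "(real d - 1) * d \<le> w v"
      using closed_3_walks_le[OF id v] d
      by (simp add: w_def algebra_simps power2_eq_square)
    then have "card (Q `` {v}) * ((real d - 1) * d) \<le> (real d + 1) * ((real d - 1) * d)"
      using mult_left_mono[of "(real d - 1) * d" "w v" "real (card (Q `` {v}))"] size[OF v]
      by (simp add: mult_ac)
    then have "card (Q `` {v}) \<le> d + 1"
      using d_pos by (simp add: mult_le_cancel_right)
    moreover have "d \<le> card (Q `` {v})"
      using card_mono[OF fin_Q R_sub_Q] card_R[OF v] by metis
    ultimately show ?thesis by linarith
  qed
  define V0 where "V0 = {v \<in> V. card (Q `` {v}) = d}"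
  have w: "w v = (real d - 1) * d + (if card (Q `` {v}) = d then real d - 1 else 0)" if v: "v \<in> V" for v
  proof (cases "card (Q `` {v}) = d")
    case True
    then have "d * w v = d * ((real d - 1) * (real d + 1))"
      using size[OF v] by (simp add: mult_ac)
    then have "w v = (real d - 1) * (real d + 1)"
      using d_pos by simp
    then show ?thesis using True by (simp add: algebra_simps)
  next
    case False
    then have "real (card (Q `` {v})) = real d + 1" using card_Q[OF v] by auto
    then have "(real d + 1) * w v = (real d + 1) * ((real d - 1) * d)"
      using size[OF v] by (simp add: mult_ac)
    then show ?thesis using False d_pos by simp
  qed
  \<comment> \<open>The excess d - 1 occurs once for each vertex of \<open>V0\<close>, and by
    \<open>cw3\<close> it adds up to (d - 1) d.\<close>
  have "(real d - 1) * d * (card V + 1) = (\<Sum>v\<in>V. w v)"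
    using cw3 by (simp add: w_def sum_subtractf closed_walks_def)
  also have "\<dots> = card V * ((real d - 1) * d) + card V0 * (real d - 1)"
    unfolding V0_def using fin by (simp add: w sum.distrib flip: sum.inter_filter)
  finally have "(real d - 1) * card V0 = (real d - 1) * d"
    by (simp add: algebra_simps)
  then have card_V0: "card V0 = d"
    using d_pos by simp
  \<comment> \<open>A class with d elements inside a set with d elements fills it, so
    \<open>V0\<close> is a single class.\<close>
  have V0_cls: "Q `` {v} = V0" if v: "v \<in> V0" for v
  proof (rule card_subset_eq)
    show "finite V0" using fin by (simp add: V0_def)
    show "Q `` {v} \<subseteq> V0"
    proof
      fix u assume "u \<in> Q `` {v}"
      then have "u \<in> V" "Q `` {u} = Q `` {v}"
        using Q_sub Q_cls[of v u] by auto
      then show "u \<in> V0"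
        using v by (simp add: V0_def)
    qed
    show "card (Q `` {v}) = card V0"
      using v card_V0 by (simp add: V0_def)
  qed
  have V0_edge: "(u, x) \<notin> E" if u: "u \<in> V0" and x: "x \<in> V0" for u x
  proof -
    have "R `` {u} = V0"
      using card_subset_eq[of V0 "R `` {u}"] R_sub_Q[of u] V0_cls[OF u] card_R[of u] card_V0 u fin
      by (auto simp: V0_def)
    then show ?thesis using x by (auto simp: R_def)
  qed
  define V1 where "V1 = V - V0"
  have V1_cls: "Q `` {u} \<subseteq> V1" if u: "u \<in> V1" for u
  proof
    fix x assume "x \<in> Q `` {u}"
    then have "x \<in> V" "Q `` {x} = Q `` {u}"
      using Q_sub Q_cls[of u x] by auto
    then show "x \<in> V1"
      using u by (auto simp: V1_def V0_def)
  qed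
  have card_V1: "card V1 = r * (d + 1)"
    using card_Diff_subset[of V0 V] fin card_V0 card_V k by (auto simp: V1_def V0_def)
  have equiv1: "equiv V1 (Q \<inter> V1 \<times> V1)"
  proof (rule equivI)
    show "refl_on V1 (Q \<inter> V1 \<times> V1)"
      using Q_self by (intro refl_onI) (auto simp: V1_def)
    show "sym (Q \<inter> V1 \<times> V1)"
      using symD[OF symQ] by (intro symI) blast
    show "trans (Q \<inter> V1 \<times> V1)"
      using transD[OF transQ] by (intro transI) blast
  qed auto
  have cls1: "(Q \<inter> V1 \<times> V1) `` {u} = Q `` {u}" if "u \<in> V1" for u
    using V1_cls[OF that] that by auto
  have card_Q1: "card (Q `` {u}) = d + 1" if "u \<in> V1" for u
    using that card_Q[of u] by (auto simp: V1_def V0_def)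
  obtain f where f: "bij_betw f V1 ({1..r} \<times> {..<d + 1})"
    "\<And>u v. u \<in> V1 \<Longrightarrow> v \<in> V1 \<Longrightarrow> fst (f u) = fst (f v) \<longleftrightarrow> (u, v) \<in> Q \<inter> V1 \<times> V1"
  proof (rule uniform_partition_coordinates[OF equiv1 _ _ card_V1])
    show "finite V1" using fin by (simp add: V1_def)
    show "card ((Q \<inter> V1 \<times> V1) `` {u}) = d + 1" if "u \<in> V1" for u
      by (simp only: cls1[OF that] card_Q1[OF that])
  qed auto
  \<comment> \<open>The coordinates number the classes in \<open>V1\<close> from 1, which leaves 0
    for \<open>V0\<close>.\<close>
  define \<kappa> where "\<kappa> u = (if u \<in> V0 then 0 else fst (f u))" for u
  \<comment> \<open>For \<open>u\<close> in \<open>V1\<close> the class has d + 1 elements, so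
    exactly one lies outside the \<open>R\<close>-neighbourhood: the only neighbour of
    \<open>u\<close> in its own class.\<close>
  define \<sigma> where "\<sigma> u = the_elem (Q `` {u} - R `` {u})" for u
  have f_range: "fst (f u) \<in> {1..r}" if "u \<in> V1" for u
    using bij_betwE[OF f(1)] that by (simp add: mem_Times_iff)
  have \<kappa>_0: "\<kappa> u = 0 \<longleftrightarrow> u \<in> V0" if "u \<in> V" for u
    using f_range[of u] that by (auto simp: \<kappa>_def V1_def)
  have \<kappa>_eq: "\<kappa> u = \<kappa> x \<longleftrightarrow> (u, x) \<in> Q" if u: "u \<in> V" and x: "x \<in> V" for u x
  proof (cases "u \<in> V0 \<or> x \<in> V0")
    case True
    have "(u, x) \<in> Q \<longleftrightarrow> u \<in> V0 \<and> x \<in> V0"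
      using True V0_cls[of u] V0_cls[of x] symD[OF symQ, of u x] symD[OF symQ, of x u] Q_self[OF u] Q_self[OF x]
      by blast
    moreover have "\<kappa> u = \<kappa> x \<longleftrightarrow> u \<in> V0 \<and> x \<in> V0"
      using True \<kappa>_0[OF u] \<kappa>_0[OF x] by auto
    ultimately show ?thesis by simp
  next
    case False
    then show ?thesis
      using f(2)[of u x] u x by (simp add: \<kappa>_def V1_def)
  qed
  have mate: "Q `` {u} - R `` {u} = {\<sigma> u}" if u: "u \<in> V1" for u
  proof -
    have "card (Q `` {u} - R `` {u}) = 1"
      using card_Diff_subset[OF finite_subset[OF R_sub_Q fin_Q] R_sub_Q, of u] card_Q1[OF u] card_R[of u] u
      by (simp add: V1_def)
    then show ?thesis
      unfolding \<sigma>_def by (metis card_1_singletonE the_elem_eq)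
  qed
  have mate': "(u, \<sigma> u) \<in> Q" "(u, \<sigma> u) \<notin> R" "\<sigma> u \<in> V1" "\<sigma> (\<sigma> u) = u" if u: "u \<in> V1" for u
  proof -
    have m: "\<sigma> u \<in> Q `` {u} - R `` {u}" using mate[OF u] by simp
    then show "(u, \<sigma> u) \<in> Q" "(u, \<sigma> u) \<notin> R" by auto
    show m1: "\<sigma> u \<in> V1" using m V1_cls[OF u] by auto
    have "u \<in> Q `` {\<sigma> u} - R `` {\<sigma> u}"
      using m symD[OF symR, of "\<sigma> u" u] symD[OF symQ, of u "\<sigma> u"] by blast
    then show "\<sigma> (\<sigma> u) = u" using mate[OF m1] by simp
  qed
  have "matched_classes V E \<kappa> \<sigma> (d + 1) r"
  proof
    show "finite V" by (rule fin)
    show "d + 1 \<ge> 2" using d by simp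
    fix u assume u: "u \<in> V"
    show "\<kappa> u \<le> r"
      using f_range[of u] u by (auto simp: \<kappa>_def V1_def)
    assume "\<kappa> u \<noteq> 0"
    then have u1: "u \<in> V1" using \<kappa>_0[OF u] u by (simp add: V1_def)
    have "\<sigma> u \<in> V" using mate'(3)[OF u1] by (simp add: V1_def)
    moreover have "(u, u) \<in> R" using u loopfree by (simp add: R_def)
    ultimately show "\<sigma> u \<in> V \<and> \<kappa> (\<sigma> u) = \<kappa> u \<and> \<sigma> (\<sigma> u) = u \<and> \<sigma> u \<noteq> u"
      using mate'[OF u1] \<kappa>_eq[OF u, of "\<sigma> u"] by auto
  next
    have "{u \<in> V. \<kappa> u = 0} = V0"
      using \<kappa>_0 by (auto simp: V0_def)
    then show "card {u \<in> V. \<kappa> u = 0} = d + 1 - 1"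
      by (simp add: card_V0)
  next
    fix i assume i: "i \<in> {1..r}"
    then have "(i, 0) \<in> f ` V1"
      using bij_betw_imp_surj_on[OF f(1)] by simp
    then obtain u where u: "u \<in> V1" "f u = (i, 0)"
      by (metis imageE)
    have uV: "u \<in> V" "\<kappa> u = i" using u by (auto simp: V1_def \<kappa>_def)
    have "{x \<in> V. \<kappa> x = i} = Q `` {u}"
    proof (intro equalityI subsetI)
      show "x \<in> Q `` {u}" if "x \<in> {x \<in> V. \<kappa> x = i}" for x
        using that \<kappa>_eq[OF uV(1), of x] uV(2) by simp
      show "x \<in> {x \<in> V. \<kappa> x = i}" if "x \<in> Q `` {u}" for x
        using that \<kappa>_eq[OF uV(1), of x] uV(2) Q_sub by auto
    qed
    then show "card {x \<in> V. \<kappa> x = i} = d + 1"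
      using card_Q1[OF u(1)] by simp
  next
    fix u x
    show "(u, x) \<in> E \<longleftrightarrow> u \<in> V \<and> x \<in> V \<and> (\<kappa> u \<noteq> \<kappa> x \<or> \<kappa> u \<noteq> 0 \<and> x = \<sigma> u)"
    proof (cases "u \<in> V \<and> x \<in> V")
      case True
      then have u: "u \<in> V" and x: "x \<in> V" by auto
      show ?thesis
      proof (cases "(u, x) \<in> Q")
        case False
        then show ?thesis using Q_outside[OF u x] \<kappa>_eq[OF u x] u x by simp
      next
        case Qux: True
        show ?thesis
        proof (cases "u \<in> V0")
          case True
          then show ?thesis
            using V0_edge[OF True] V0_cls[OF True] \<kappa>_eq[OF u x] \<kappa>_0[OF u] Qux by auto
        next
          case False
          then have "x = \<sigma> u \<longleftrightarrow> (u, x) \<in> E"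
          proof -
            have "x \<in> Q `` {u} - R `` {u} \<longleftrightarrow> x = \<sigma> u"
              using mate[of u] False u by (simp add: V1_def)
            then show ?thesis
              using Qux u x by (simp add: R_def)
          qed
          then show ?thesis
            using False \<kappa>_eq[OF u x] \<kappa>_0[OF u] Qux u x by simp
        qed
      qed
    qed (use sub in auto)
  qed
  then show ?thesis by blast
qed

section \<open>The graphs \<open>X\<close> and their isomorphism type\<close>

text \<open>The constituents of the inner join are numbered from 1, so 0 is free for the edgeless
  part.\<close>

definition X_class :: "nat + nat \<times> nat \<times> nat \<Rightarrow> nat" where
  "X_class = case_sum (\<lambda>_. 0) fst"

text \<open>The vertices of each K_2 are 0 and 1, which \<open>1 - b\<close> swaps; the edgeless
  part is left fixed.\<close>

definition X_mate :: "nat + nat \<times> nat \<times> nat \<Rightarrow> nat + nat \<times> nat \<times> nat" where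
  "X_mate = case_sum Inl (\<lambda>(i, j, b). Inr (i, j, 1 - b))"

lemma X_class_simps [simp]: "X_class (Inl a) = 0" "X_class (Inr p) = fst p"
  by (simp_all add: X_class_def)

lemma X_mate_simps [simp]: "X_mate (Inl a) = Inl a" "X_mate (Inr (i, j, b)) = Inr (i, j, 1 - b)"
  by (simp_all add: X_mate_def)

lemma pverts_X_graph:
  "pverts (X_graph h r) = Inl ` {..<h - 1} \<union> Inr ` ({1..r} \<times> {1..h div 2} \<times> {..<2})"
  by (auto simp: X_graph_def join2_graph_def join_graph_def disjoint_union_graph_def
      complete_graph_def edgeless_graph_def)

lemma parcs_X_graph:
  "(u, w) \<in> parcs (X_graph h r) \<longleftrightarrow> u \<in> pverts (X_graph h r) \<and> w \<in> pverts (X_graph h r) \<and>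
    (X_class u \<noteq> X_class w \<or> X_class u \<noteq> 0 \<and> w = X_mate u)"
proof -
  have two: "b < (2::nat) \<and> c < 2 \<and> b \<noteq> c \<longleftrightarrow> b < 2 \<and> c < 2 \<and> c = 1 - b" for b c :: nat
    by arith
  show ?thesis
    unfolding pverts_X_graph using two
    by (cases u; cases w) (auto simp: X_graph_def join2_graph_def join_graph_def
        disjoint_union_graph_def complete_graph_def edgeless_graph_def)
qed

lemma X_graph_matched_classes:
  assumes "even h" "h \<ge> 2"
  shows "matched_classes (pverts (X_graph h r)) (parcs (X_graph h r)) X_class X_mate h r"
proof
  show "finite (pverts (X_graph h r))"
    by (simp add: pverts_X_graph)
  show "(u, w) \<in> parcs (X_graph h r) \<longleftrightarrow> u \<in> pverts (X_graph h r) \<and> w \<in> pverts (X_graph h r) \<and>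
    (X_class u \<noteq> X_class w \<or> X_class u \<noteq> 0 \<and> w = X_mate u)" for u w
    by (rule parcs_X_graph)
  fix u assume u: "u \<in> pverts (X_graph h r)"
  show "X_class u \<le> r"
    using u by (auto simp: pverts_X_graph)
  \<comment> \<open>Truncated subtraction sends 0 to 1 and every positive number to 0.\<close>
  have flip: "Suc 0 - b \<noteq> b" for b
    by arith
  assume "X_class u \<noteq> 0"
  then show "X_mate u \<in> pverts (X_graph h r) \<and> X_class (X_mate u) = X_class u \<and>
      X_mate (X_mate u) = u \<and> X_mate u \<noteq> u"
    using u flip by (auto simp: pverts_X_graph)
next
  have "{u \<in> pverts (X_graph h r). X_class u = 0} = Inl ` {..<h - 1}"
    by (auto simp: pverts_X_graph)
  then show "card {u \<in> pverts (X_graph h r). X_class u = 0} = h - 1"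
    by (simp add: card_image)
next
  fix i assume i: "i \<in> {1..r}"
  have "{u \<in> pverts (X_graph h r). X_class u = i} = Inr ` ({i} \<times> {1..h div 2} \<times> {..<2})"
    using i by (auto simp: pverts_X_graph)
  then show "card {u \<in> pverts (X_graph h r). X_class u = i} = h"
    using assms(1) by (simp add: card_image card_cartesian_product)
qed (use assms in auto)

text \<open>The pairs of mates partition the class, and there are \<open>h div 2\<close> of them
  because \<open>h\<close> is even.\<close>

lemma (in matched_classes) pairing_of_class:
  assumes "even h" "i \<in> {1..r}"
  shows "\<exists>p. bij_betw p {u \<in> V. \<kappa> u = i} ({1..h div 2} \<times> {..<2 :: nat}) \<and>
    (\<forall>u\<in>{u \<in> V. \<kappa> u = i}. \<forall>w\<in>{u \<in> V. \<kappa> u = i}. fst (p u) = fst (p w) \<longleftrightarrow> w = u \<or> w = \<sigma> u)"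
proof -
  let ?A = "{u \<in> V. \<kappa> u = i}"
  let ?Q = "{(u, w). u \<in> ?A \<and> w \<in> ?A \<and> (w = u \<or> w = \<sigma> u)}"
  have \<sigma>: "\<sigma> u \<in> ?A" "\<sigma> (\<sigma> u) = u" "\<sigma> u \<noteq> u" if "u \<in> ?A" for u
    using that assms(2) mate[of u] by auto
  have equiv: "equiv ?A ?Q"
  proof (rule equivI)
    show "refl_on ?A ?Q" by (auto intro!: refl_onI)
    show "sym ?Q" using \<sigma>(2) by (auto intro!: symI)
    show "trans ?Q" using \<sigma>(2) by (auto intro!: transI)
  qed auto
  have "card (?Q `` {u}) = 2" if u: "u \<in> ?A" for u
  proof -
    have "?Q `` {u} = {u, \<sigma> u}" using u \<sigma>(1)[OF u] by auto
    then show ?thesis using \<sigma>(3)[OF u] by simp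
  qed
  moreover have "card ?A = (h div 2) * 2"
    using card_class[OF assms(2)] assms(1) by simp
  ultimately obtain p where p: "bij_betw p ?A ({1..h div 2} \<times> {..<2 :: nat})"
    "\<And>u w. u \<in> ?A \<Longrightarrow> w \<in> ?A \<Longrightarrow> fst (p u) = fst (p w) \<longleftrightarrow> (u, w) \<in> ?Q"
    using uniform_partition_coordinates[OF equiv finite_class, of 2 "h div 2"] by auto
  then show ?thesis
    by (intro exI[of _ p]) auto
qed

text \<open>Adjacency is determined by classes and mates, so it suffices to glue bijections of the
  individual classes that respect the pairs.\<close>

lemma matched_classes_iso_X_graph:
  assumes Y: "pair_graph Y" and m: "matched_classes (pverts Y) (parcs Y) \<kappa> \<sigma> h r" and even: "even h"
  shows "digraph_iso (with_proj Y) (with_proj (X_graph h r))"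
proof -
  interpret Y: matched_classes "pverts Y" "parcs Y" \<kappa> \<sigma> h r by fact
  interpret X: matched_classes "pverts (X_graph h r)" "parcs (X_graph h r)" X_class X_mate h r
    by (rule X_graph_matched_classes[OF even Y.h])
  let ?C = "\<lambda>i. {u \<in> pverts Y. \<kappa> u = i}"
  have "\<exists>e. bij_betw e (?C 0) {..<h - 1}"
    by (rule finite_same_card_bij) (simp_all add: Y.finite_class Y.card_class0)
  then obtain e where e: "bij_betw e (?C 0) {..<h - 1}" by blast
  have "\<exists>p. \<forall>i\<in>{1..r}. bij_betw (p i) (?C i) ({1..h div 2} \<times> {..<2 :: nat}) \<and>
      (\<forall>u\<in>?C i. \<forall>w\<in>?C i. fst (p i u) = fst (p i w) \<longleftrightarrow> w = u \<or> w = \<sigma> u)"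
    by (rule bchoice) (use Y.pairing_of_class[OF even] in blast)
  then obtain p where p: "\<And>i. i \<in> {1..r} \<Longrightarrow> bij_betw (p i) (?C i) ({1..h div 2} \<times> {..<2 :: nat})"
    "\<And>i u w. i \<in> {1..r} \<Longrightarrow> u \<in> ?C i \<Longrightarrow> w \<in> ?C i \<Longrightarrow> fst (p i u) = fst (p i w) \<longleftrightarrow> w = u \<or> w = \<sigma> u"
    by blast
  define f where "f u = (if \<kappa> u = 0 then Inl (e u) else Inr (\<kappa> u, p (\<kappa> u) u))" for u
  have cls: "\<kappa> u \<in> {1..r}" if "u \<in> pverts Y" "\<kappa> u \<noteq> 0" for u
    using Y.class_le[OF that(1)] that(2) by simp
  have f_class: "X_class (f u) = \<kappa> u" for u
    by (simp add: f_def)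
  have f_in: "f u \<in> pverts (X_graph h r)" if u: "u \<in> pverts Y" for u
  proof (cases "\<kappa> u = 0")
    case True
    then show ?thesis using bij_betwE[OF e] u by (simp add: f_def pverts_X_graph)
  next
    case False
    then have "p (\<kappa> u) u \<in> {1..h div 2} \<times> {..<2}"
      using bij_betwE[OF p(1)[OF cls[OF u False]]] u by simp
    then show ?thesis
      using False cls[OF u False] by (auto simp: f_def pverts_X_graph)
  qed
  have inj: "inj_on f (pverts Y)"
  proof (rule inj_onI)
    fix u w assume u: "u \<in> pverts Y" and w: "w \<in> pverts Y" and eq: "f u = f w"
    then have \<kappa>: "\<kappa> u = \<kappa> w" using f_class by metis
    show "u = w"
    proof (cases "\<kappa> u = 0")
      case True
      then show ?thesis
        using eq \<kappa> u w bij_betw_imp_inj_on[OF e] by (auto simp: f_def dest: inj_onD)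
    next
      case False
      then show ?thesis
        using eq \<kappa> u w inj_onD[OF bij_betw_imp_inj_on[OF p(1)[OF cls[OF u False]]], of u w]
        by (simp add: f_def)
    qed
  qed
  \<comment> \<open>Both graphs are instances of \<open>matched_classes\<close> with the same
    parameters, so they have equally many vertices and injectivity suffices.\<close>
  have "f ` pverts Y = pverts (X_graph h r)"
  proof (rule card_subset_eq)
    show "card (f ` pverts Y) = card (pverts (X_graph h r))"
      by (simp add: card_image[OF inj] Y.card_total X.card_total)
  qed (use f_in X.finite_V in auto)
  then have bij: "bij_betw f (pverts Y) (pverts (X_graph h r))"
    using inj by (simp add: bij_betw_def)
  have f_mate: "f w = X_mate (f u) \<longleftrightarrow> w = \<sigma> u"
    if u: "u \<in> pverts Y" and w: "w \<in> pverts Y" and \<kappa>: "\<kappa> u = \<kappa> w" "\<kappa> u \<noteq> 0" for u w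
  proof -
    let ?p = "p (\<kappa> u)"
    have flip: "b \<noteq> Suc 0 - b" for b
      by arith
    have "?p u \<in> {1..h div 2} \<times> {..<2}" "?p w \<in> {1..h div 2} \<times> {..<2}"
      using bij_betwE[OF p(1)[OF cls[OF u \<kappa>(2)]]] u w \<kappa> by simp_all
    \<comment> \<open>As second coordinates are 0 or 1, distinct points with equal first coordinate
      are exactly those that differ by the flip.\<close>
    then have "f w = X_mate (f u) \<longleftrightarrow> fst (?p u) = fst (?p w) \<and> ?p u \<noteq> ?p w"
      using \<kappa> flip by (cases "?p u"; cases "?p w") (auto simp: f_def)
    also have "fst (?p u) = fst (?p w) \<longleftrightarrow> w = u \<or> w = \<sigma> u"
      using p(2)[OF cls[OF u \<kappa>(2)]] u w \<kappa> by simp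
    also have "?p u \<noteq> ?p w \<longleftrightarrow> u \<noteq> w"
      using inj_on_eq_iff[OF bij_betw_imp_inj_on[OF p(1)[OF cls[OF u \<kappa>(2)]]], of u w] u w \<kappa> by simp
    finally show ?thesis
      using Y.mate[OF u \<kappa>(2)] by auto
  qed
  show ?thesis
  proof (rule digraph_isoI[OF _ bij])
    show "pair_wf_digraph Y"
      using Y by (simp add: pair_graph_def pair_digraph_def pair_fin_digraph_def)
    show "parcs (X_graph h r) \<subseteq> pverts (X_graph h r) \<times> pverts (X_graph h r)"
      by (rule X.sub)
    show "(u, w) \<in> parcs Y \<longleftrightarrow> (f u, f w) \<in> parcs (X_graph h r)" if "u \<in> pverts Y" "w \<in> pverts Y" for u w
      using that f_in[OF that(1)] f_in[OF that(2)] f_mate[OF that]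
      by (auto simp: Y.arc_iff[of u w] X.arc_iff[of "f u" "f w"] f_class)
  qed
qed

section \<open>The complete case and the final assembly\<close>

lemma complete_digraph_iso:
  assumes "pair_graph Y" "pair_graph X" "card (pverts Y) = card (pverts X)"
    and "\<And>u w. (u, w) \<in> parcs Y \<longleftrightarrow> u \<in> pverts Y \<and> w \<in> pverts Y \<and> u \<noteq> w"
    and "\<And>u w. (u, w) \<in> parcs X \<longleftrightarrow> u \<in> pverts X \<and> w \<in> pverts X \<and> u \<noteq> w"
  shows "digraph_iso (with_proj Y) (with_proj X)"
proof -
  obtain f where f: "bij_betw f (pverts Y) (pverts X)"
    using finite_same_card_bij[OF _ _ assms(3)] pair_graphD(1) assms(1,2) by metis
  show ?thesis
  proof (rule digraph_isoI[OF _ f])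
    show "pair_wf_digraph Y"
      using assms(1) by (simp add: pair_graph_def pair_digraph_def pair_fin_digraph_def)
    show "parcs X \<subseteq> pverts X \<times> pverts X"
      by (rule pair_graphD[OF assms(2)])
    show "(u, v) \<in> parcs Y \<longleftrightarrow> (f u, f v) \<in> parcs X" if "u \<in> pverts Y" "v \<in> pverts Y" for u v
      using that bij_betwE[OF f] inj_on_eq_iff[OF bij_betw_imp_inj_on[OF f]]
      by (auto simp: assms(4,5))
  qed
qed

lemma (in regular_graph) complete_if_degree_max:
  assumes "d = 1"
  shows "(u, w) \<in> E \<longleftrightarrow> u \<in> V \<and> w \<in> V \<and> u \<noteq> w"
proof (cases "u \<in> V")
  case True
  have "E `` {u} = V - {u}"
  proof (rule card_subset_eq)
    show "E `` {u} \<subseteq> V - {u}" using nbrs_subset loopfree by auto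
    show "card (E `` {u}) = card (V - {u})"
      using True assms fin by (simp add: regular card_V)
  qed (use fin in simp)
  then show ?thesis using True by auto
qed (use sub in auto)

lemma sym_graph_pair_graph: "pair_graph G \<Longrightarrow> sym_graph (pverts G) (parcs G)"
  using pair_graphD[of G] by unfold_locales auto

text \<open>The list holds the coefficients of x^4 + d x^3 - x^2 - d x from the constant term
  upwards, the format of \<open>walk_polynomial_transfer\<close>.\<close>

lemma walk4_sum:
  fixes d :: real
  shows "(\<Sum>i\<le>4. [0, - d, - 1, d, 1] ! i * walks E i v u)
    = walks E 4 v u + d * walks E 3 v u - walks E 2 v u - d * walks E (Suc 0) v u"
  by (simp add: eval_nat_numeral)

theorem theorem4p2:
  fixes h r :: nat and Y :: "'a pair_pre_digraph"
  assumes "even h" and "h \<ge> 2" and "r \<ge> 1"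
    and "pair_graph Y"
    and "adjacency_spectrum Y = adjacency_spectrum (X_graph h r)"
  shows "digraph_iso (with_proj Y) (with_proj (X_graph h r))"
proof -
  let ?X = "X_graph h r"
  interpret X: matched_classes "pverts ?X" "parcs ?X" X_class X_mate h r
    by (rule X_graph_matched_classes[OF assms(1,2)])
  interpret Y0: sym_graph "pverts Y" "parcs Y"
    by (rule sym_graph_pair_graph[OF assms(4)])
  have cw: "closed_walks (pverts Y) (parcs Y) j = closed_walks (pverts ?X) (parcs ?X) j" for j
    by (rule closed_walks_cospectral[OF Y0.sym_graph_axioms X.sym_graph_axioms assms(5)])
  have card_Y: "card (pverts Y) = card (pverts ?X)"
    using cw[of 0] by (simp add: closed_walks_0)
  have reg: "card (parcs Y `` {v}) = r * h" if "v \<in> pverts Y" for v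
    by (rule regular_of_closed_walks[OF Y0.sym_graph_axioms X.sym_graph_axioms cw X.degree that])
  interpret Y: regular_graph "pverts Y" "parcs Y" "r * h" "h - 1"
  proof unfold_locales
    show "(v, v) \<notin> parcs Y" for v
      using pair_graphD(4)[OF assms(4)] by (auto simp: irrefl_def)
  qed (simp_all add: reg card_Y X.card_total)
  show ?thesis
  \<comment> \<open>For \<open>h = 2\<close> one has d = 1, and the factors d - 1 in the counting
    vanish; here regularity alone forces both graphs to be complete.\<close>
  proof (cases "h = 2")
    case True
    then have "h - 1 = 1" by simp
    then show ?thesis
      using complete_digraph_iso[OF assms(4) pair_graph_X_graph card_Y]
        Y.complete_if_degree_max X.complete_if_degree_max by blast
  next
    case False
    let ?c = "\<lambda>i. [0, - real (h - 1), - 1, real (h - 1), 1] ! i"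
    have "(\<Sum>i\<le>4. ?c i * walks (parcs Y) i v u) = real (r * h) ^ 3 - real (r * h)"
      if "v \<in> pverts Y" "u \<in> pverts Y" for v u
      using that
    proof (rule walk_polynomial_transfer[OF Y0.sym_graph_axioms X.sym_graph_axioms cw Y.regular X.regular, rotated -2])
      show "(\<Sum>i\<le>4. ?c i * walks (parcs ?X) i w x) = real (r * h) ^ 3 - real (r * h)"
        if "w \<in> pverts ?X" "x \<in> pverts ?X" for w x
        using X.walk4[unfolded X.walk4_identity_def] that unfolding walk4_sum by blast
    qed
    then have "Y.walk4_identity"
      unfolding Y.walk4_identity_def walk4_sum by blast
    then have "\<exists>\<kappa> \<sigma>. matched_classes (pverts Y) (parcs Y) \<kappa> \<sigma> (h - 1 + 1) r"
    proof (rule Y.matched_classes_if_walks)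
      show "h - 1 \<ge> 2" using assms(1,2) False by presburger
      show "r * h = r * (h - 1 + 1)" using assms(2) by simp
    qed (use X.sum_closed_3_walks in \<open>simp only: card_Y cw\<close>)
    then show ?thesis
      using matched_classes_iso_X_graph[OF assms(4) _ assms(1)] assms(2) by auto
  qed
qed

end
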